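(* Let $\alpha\in(0,1)$ and let $\Gamma$ be a subgroup of $\mathrm{M\ddot ob}(\mathbb S)$ that contains a hyperbolic element. If $f\in \mathrm{Sym}$ satisfies $f\Gamma f^{-1}\subset \mathrm{Diff}_+^{1+\alpha}(\mathbb S)$, then $f\in \mathrm{Diff}_+^{1+\alpha}(\mathbb S)$.
   Context: $\mathbb S=\mathbb R/2\pi\mathbb Z$ is the unit circle, the boundary of the unit disk $\mathbb D$. $\mathrm{M\ddot ob}(\mathbb S)\cong \mathrm{PSL}(2,\mathbb R)$ is the group of restrictions to $\mathbb S$ of the Möbius transformations preserving $\mathbb D$. $\mathrm{Diff}_+^{1+\alpha}(\mathbb S)$ is the group of orientation-preserving diffeomorphisms $g$ of $\mathbb S$ whose derivative is $\alpha$-Hölder continuous: there is $c=c(g)\ge 0$ with $|g'(x)-g'(y)|\le c|x-y|^\alpha$ for all $x,y\in\mathbb S$. For an orientation-preserving self-homeomorphism $g$ of $\mathbb S$ (identified with a lift $\mathbb R\to\mathbb R$) put $m_g(x,t)=\frac{g(x+t)-g(x)}{g(x)-g(x-t)}$ for $x\in\mathbb S$, $t>0$. $g$ is quasisymmetric if there is $M\ge1$ with $1/M\le m_g(x,t)\le M$ for all $x,t$. A quasisymmetric $g$ is symmetric if $m_g(x,t)\to1$ as $t\to0$ uniformly in $x$; equivalently, $g$ extends to a quasiconformal self-homeomorphism of $\mathbb D$ whose complex dilatation $\mu$ satisfies $\operatorname{ess\,sup}_{|z|>1-t}|\mu(z)|\to0$ as $t\to0$. $\mathrm{Sym}$ is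 the group of all symmetric self-homeomorphisms of $\mathbb S$. *)

theory Defs
  imports "HOL-Analysis.Analysis" "HOL-Algebra.Bij"
begin

(* Self-maps of the circle are elements of the library group BijGroup of all (extensional)
   bijections of the unit circle in the complex plane, with x |-> cis x identifying
   R / 2 pi Z with it. *)

abbreviation unit_circle :: "complex set" where
  "unit_circle \<equiv> sphere 0 1"

abbreviation circle_bij :: "(complex \<Rightarrow> complex) monoid" where
  "circle_bij \<equiv> BijGroup unit_circle"

definition circle_lift :: "(complex \<Rightarrow> complex) \<Rightarrow> (real \<Rightarrow> real) \<Rightarrow> bool" where
  "circle_lift g G \<longleftrightarrow> continuous_on UNIV G \<and> (\<forall>x. g (cis x) = cis (G x))"

definition circle_homeo_plus :: "(complex \<Rightarrow> complex) set" where
  "circle_homeo_plus =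
     {g \<in> extensional unit_circle.
        (\<exists>h. homeomorphism unit_circle unit_circle g h) \<and>
        (\<exists>G. circle_lift g G \<and> strict_mono G)}"

(* The nonvanishing condition says that no point of the disk is sent to infinity; it is needed
   because division by zero yields 0, which lies in the disk. *)
definition Mob_circle :: "(complex \<Rightarrow> complex) set" where
  "Mob_circle =
     {restrict (moebius a b c d) unit_circle | a b c d :: complex.
        a * d - b * c \<noteq> 0 \<and> (\<forall>z\<in>ball 0 1. c * z + d \<noteq> 0) \<and>
        moebius a b c d ` ball 0 1 = ball 0 1}"

(* On the circle the identity fixes every point (and card is then 0), while elliptic elements
   fix none and parabolic elements exactly one. *)
definition hyperbolic :: "(complex \<Rightarrow> complex) \<Rightarrow> bool" where
  "hyperbolic g \<longleftrightarrow> g \<in> Mob_circle \<and> card {z \<in> unit_circle. g z = z} = 2"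

(* Two lifts of an orientation-preserving homeomorphism differ by a constant in 2 pi Z, so the
   existential quantifier over lifts in the definitions below is the same as a universal one. *)

definition circle_C1 :: "(complex \<Rightarrow> complex) \<Rightarrow> bool" where
  "circle_C1 g \<longleftrightarrow>
     (\<exists>G. circle_lift g G \<and> (\<forall>x. G differentiable (at x)) \<and> continuous_on UNIV (deriv G))"

definition circle_diffeo_plus :: "(complex \<Rightarrow> complex) set" where
  "circle_diffeo_plus =
     {g \<in> circle_homeo_plus. circle_C1 g \<and> circle_C1 (inv\<^bsub>circle_bij\<^esub> g)}"

(* The derivative of a lift is 2 pi-periodic and every pair of points of R / 2 pi Z has
   representatives realising their distance, so the Hoelder bound over all real x, y is the one
   for the distance of R / 2 pi Z, with the same constant. *)
definition circle_diffeo_holder :: "real \<Rightarrow> (complex \<Rightarrow> complex) set" where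
  "circle_diffeo_holder \<alpha> =
     {g \<in> circle_diffeo_plus.
        \<exists>G. circle_lift g G \<and>
          (\<exists>c\<ge>0. \<forall>x y. \<bar>deriv G x - deriv G y\<bar> \<le> c * \<bar>x - y\<bar> powr \<alpha>)}"

definition qs_ratio :: "(real \<Rightarrow> real) \<Rightarrow> real \<Rightarrow> real \<Rightarrow> real" where
  "qs_ratio G x t = (G (x + t) - G x) / (G x - G (x - t))"

definition quasisymmetric :: "(complex \<Rightarrow> complex) \<Rightarrow> bool" where
  "quasisymmetric g \<longleftrightarrow> g \<in> circle_homeo_plus \<and>
     (\<exists>G. circle_lift g G \<and>
        (\<exists>M\<ge>1. \<forall>x. \<forall>t>0. 1 / M \<le> qs_ratio G x t \<and> qs_ratio G x t \<le> M))"

definition Sym_circle :: "(complex \<Rightarrow> complex) set" where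
  "Sym_circle =
     {g. quasisymmetric g \<and>
        (\<exists>G. circle_lift g G \<and>
           uniform_limit UNIV (\<lambda>t x. qs_ratio G x t) (\<lambda>_. 1) (at_right 0))}"

end

theory Submission
  imports Defs
begin

text \<open>
  Only one hyperbolic element \<open>\<gamma>\<close> of the group is used, together with its inverse.  Put
  \<open>g = f \<gamma> f\<inverse>\<close>, which is a diffeomorphism with \<open>\<alpha>\<close>-Hoelder derivative.

  Sending one fixed point of \<open>\<gamma>\<close> to infinity and the other one to \<open>0\<close> by a Moebius transformation gives a
  real coordinate \<open>v\<close> on the circle minus one point in which \<open>\<gamma>\<close> is \<open>v \<mapsto> A v\<close>
  (\<open>Mob_circle_linear_in_chart\<close>); after replacing \<open>\<gamma>\<close> by its inverse, \<open>0 < A < 1\<close>.  If \<open>F\<close>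
  denotes a lift of \<open>f\<close> read in this coordinate and \<open>G\<close> the right lift of \<open>g\<close>, then
  \<open>G (F v) = F (A v)\<close>.

  The multiplier \<open>\<mu>\<close> of \<open>G\<close> at the fixed point \<open>F 0\<close> is less than \<open>1\<close>: symmetry makes
  the increments of \<open>F\<close> at \<open>0\<close> shrink geometrically, so the iterates of \<open>G\<close> contract at a definite rate
  (\<open>multiplier_less_1\<close>).  Hence Sternberg's theorem in class \<open>C\<^sup>1\<^sup>+\<^sup>\<alpha>\<close> applies and
  gives a local diffeomorphism \<open>h\<close> with \<open>h \<circ> G = \<mu> h\<close>, whose derivative is again Hoelder
  (\<open>Sternberg_linearization\<close>).  Then \<open>H = h \<circ> F\<close> satisfies \<open>H (A v) = \<mu> H v\<close>.

  This is where symmetry becomes rigidity.  The ratio of the two increments of \<open>H\<close> over \<open>[v, v + t]\<close>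
  and \<open>[v - t, v]\<close> does not change when \<open>v\<close> and \<open>t\<close> are multiplied by \<open>A\<^sup>n\<close>, and
  it tends to \<open>1\<close> along that sequence because \<open>f\<close> is symmetric and smooth changes of coordinates do
  not matter in the limit.  So it equals \<open>1\<close> (\<open>linearized_midpoint\<close>), \<open>H\<close> is affine, and \<open>F\<close> is
  the composition of an affine map with the inverse of \<open>h\<close> near \<open>0\<close>.  The relation \<open>G \<circ> F = F \<circ> A\<close>
  spreads this regularity over the whole line, that is, over the circle minus one fixed point of
  \<open>\<gamma>\<close> (\<open>holder_diffeo_on_basin\<close>).  Exchanging the two fixed points covers the remaining point.
\<close>

section \<open>Hoelder continuous functions of a real variable\<close>

definition holder_on :: "real \<Rightarrow> real set \<Rightarrow> (real \<Rightarrow> real) \<Rightarrow> bool" where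
  "holder_on \<alpha> S f \<longleftrightarrow> (\<exists>c\<ge>0. \<forall>x\<in>S. \<forall>y\<in>S. \<bar>f x - f y\<bar> \<le> c * \<bar>x - y\<bar> powr \<alpha>)"

lemma holder_onI:
  assumes "\<And>x y. x \<in> S \<Longrightarrow> y \<in> S \<Longrightarrow> \<bar>f x - f y\<bar> \<le> c * \<bar>x - y\<bar> powr \<alpha>" "c \<ge> 0"
  shows "holder_on \<alpha> S f"
  using assms unfolding holder_on_def by blast

lemma holder_onE:
  assumes "holder_on \<alpha> S f"
  obtains c where "c \<ge> 0" "\<And>x y. x \<in> S \<Longrightarrow> y \<in> S \<Longrightarrow> \<bar>f x - f y\<bar> \<le> c * \<bar>x - y\<bar> powr \<alpha>"
  using assms unfolding holder_on_def by blast

lemma holder_on_subset: "holder_on \<alpha> S f \<Longrightarrow> T \<subseteq> S \<Longrightarrow> holder_on \<alpha> T f"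
  unfolding holder_on_def by blast

lemma holder_on_cong: "holder_on \<alpha> S f \<Longrightarrow> (\<And>x. x \<in> S \<Longrightarrow> f x = g x) \<Longrightarrow> holder_on \<alpha> S g"
  unfolding holder_on_def by simp

lemma holder_on_const: "holder_on \<alpha> S (\<lambda>_. k)"
  by (rule holder_onI[where c = 0]) auto

lemma holder_on_imp_continuous_on:
  assumes "holder_on \<alpha> S f" "\<alpha> > 0"
  shows "continuous_on S f"
proof -
  obtain c where c: "c \<ge> 0" "\<And>x y. x \<in> S \<Longrightarrow> y \<in> S \<Longrightarrow> \<bar>f x - f y\<bar> \<le> c * \<bar>x - y\<bar> powr \<alpha>"
    using assms(1) by (auto elim: holder_onE)
  show ?thesis
    unfolding continuous_on_def
  proof
    fix x assume x: "x \<in> S"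
    have "((\<lambda>y. y) \<longlongrightarrow> x) (at x within S)"
      by (rule tendsto_ident_at)
    then have "((\<lambda>y. c * \<bar>y - x\<bar> powr \<alpha>) \<longlongrightarrow> c * \<bar>x - x\<bar> powr \<alpha>) (at x within S)"
      by (intro tendsto_intros) (use assms(2) in auto)
    then have "((\<lambda>y. c * \<bar>y - x\<bar> powr \<alpha>) \<longlongrightarrow> 0) (at x within S)" by simp
    moreover have "\<forall>\<^sub>F y in at x within S. norm (f y - f x) \<le> c * \<bar>y - x\<bar> powr \<alpha>"
      using c(2) x by (auto simp: eventually_at_filter)
    ultimately have "((\<lambda>y. f y - f x) \<longlongrightarrow> 0) (at x within S)"
      by (rule Lim_null_comparison[rotated])
    then show "(f \<longlongrightarrow> f x) (at x within S)"
      by (simp add: LIM_zero_iff)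
  qed
qed

lemma holder_on_mult:
  assumes "holder_on \<alpha> S f" "holder_on \<alpha> S g"
    and "\<And>x. x \<in> S \<Longrightarrow> \<bar>f x\<bar> \<le> A" "\<And>x. x \<in> S \<Longrightarrow> \<bar>g x\<bar> \<le> B"
  shows "holder_on \<alpha> S (\<lambda>x. f x * g x)"
proof (cases "S = {}")
  case False
  then have AB: "A \<ge> 0" "B \<ge> 0" using assms(3,4) by (meson abs_ge_zero all_not_in_conv order_trans)+
  obtain c where c: "c \<ge> 0" "\<And>x y. x \<in> S \<Longrightarrow> y \<in> S \<Longrightarrow> \<bar>f x - f y\<bar> \<le> c * \<bar>x - y\<bar> powr \<alpha>"
    using assms(1) by (auto elim: holder_onE)
  obtain d where d: "d \<ge> 0" "\<And>x y. x \<in> S \<Longrightarrow> y \<in> S \<Longrightarrow> \<bar>g x - g y\<bar> \<le> d * \<bar>x - y\<bar> powr \<alpha>"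
    using assms(2) by (auto elim: holder_onE)
  show ?thesis
  proof (rule holder_onI[where c = "A * d + c * B"])
    fix x y assume xy: "x \<in> S" "y \<in> S"
    have "f x * g x - f y * g y = f x * (g x - g y) + (f x - f y) * g y"
      by (simp add: algebra_simps)
    then have "\<bar>f x * g x - f y * g y\<bar> \<le> \<bar>f x\<bar> * \<bar>g x - g y\<bar> + \<bar>f x - f y\<bar> * \<bar>g y\<bar>"
      by (metis abs_mult abs_triangle_ineq)
    also have "\<dots> \<le> A * (d * \<bar>x - y\<bar> powr \<alpha>) + (c * \<bar>x - y\<bar> powr \<alpha>) * B"
      by (intro add_mono mult_mono) (use assms c d xy AB in auto)
    finally show "\<bar>f x * g x - f y * g y\<bar> \<le> (A * d + c * B) * \<bar>x - y\<bar> powr \<alpha>"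
      by (simp add: algebra_simps)
  qed (use AB c d in auto)
qed (auto simp: holder_on_def intro: exI[of _ 0])

lemma holder_on_compose_lipschitz:
  assumes "holder_on \<alpha> T f" "\<alpha> \<ge> 0" "K-lipschitz_on S g" "g ` S \<subseteq> T"
  shows "holder_on \<alpha> S (\<lambda>x. f (g x))"
proof -
  obtain c where c: "c \<ge> 0" "\<And>x y. x \<in> T \<Longrightarrow> y \<in> T \<Longrightarrow> \<bar>f x - f y\<bar> \<le> c * \<bar>x - y\<bar> powr \<alpha>"
    using assms(1) by (auto elim: holder_onE)
  have K: "K \<ge> 0" using assms(3) lipschitz_on_def by blast
  show ?thesis
  proof (rule holder_onI[where c = "c * K powr \<alpha>"])
    fix x y assume xy: "x \<in> S" "y \<in> S"
    have "\<bar>f (g x) - f (g y)\<bar> \<le> c * \<bar>g x - g y\<bar> powr \<alpha>"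
      using xy assms(4) by (intro c) auto
    also have "\<dots> \<le> c * (K * \<bar>x - y\<bar>) powr \<alpha>"
      using lipschitz_onD[OF assms(3) xy] c(1) assms(2)
      by (intro mult_left_mono powr_mono2) (auto simp: dist_real_def)
    finally show "\<bar>f (g x) - f (g y)\<bar> \<le> (c * K powr \<alpha>) * \<bar>x - y\<bar> powr \<alpha>"
      using K by (simp add: powr_mult)
  qed (use c in auto)
qed

lemma lipschitz_compose_holder_on:
  assumes "holder_on \<alpha> S f" "K-lipschitz_on T \<phi>" "f ` S \<subseteq> T"
  shows "holder_on \<alpha> S (\<lambda>x. \<phi> (f x))"
proof -
  obtain c where c: "c \<ge> 0" "\<And>x y. x \<in> S \<Longrightarrow> y \<in> S \<Longrightarrow> \<bar>f x - f y\<bar> \<le> c * \<bar>x - y\<bar> powr \<alpha>"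
    using assms(1) by (auto elim: holder_onE)
  have K: "K \<ge> 0" using assms(2) lipschitz_on_def by blast
  show ?thesis
  proof (rule holder_onI[where c = "K * c"])
    fix x y assume xy: "x \<in> S" "y \<in> S"
    have "\<bar>\<phi> (f x) - \<phi> (f y)\<bar> \<le> K * \<bar>f x - f y\<bar>"
      using lipschitz_onD[OF assms(2), of "f x" "f y"] assms(3) xy by (auto simp: dist_real_def)
    also have "\<dots> \<le> K * (c * \<bar>x - y\<bar> powr \<alpha>)"
      by (intro mult_left_mono c K xy)
    finally show "\<bar>\<phi> (f x) - \<phi> (f y)\<bar> \<le> K * c * \<bar>x - y\<bar> powr \<alpha>" by simp
  qed (use c K in auto)
qed

lemma lipschitz_on_of_deriv_bound:
  fixes f f' :: "real \<Rightarrow> real"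
  assumes "\<And>x. x \<in> S \<Longrightarrow> (f has_real_derivative f' x) (at x within S)" "convex S"
    "\<And>x. x \<in> S \<Longrightarrow> \<bar>f' x\<bar> \<le> C" "0 \<le> C"
  shows "C-lipschitz_on S f"
proof (rule lipschitz_onI)
  fix x y assume xy: "x \<in> S" "y \<in> S"
  show "dist (f x) (f y) \<le> C * dist x y"
    using field_differentiable_bound[OF assms(2) assms(1), of C x y] assms(3) xy
    by (auto simp: dist_norm)
qed fact

lemma lipschitz_on_inverse:
  fixes m :: real assumes "m > 0" shows "(1 / m\<^sup>2)-lipschitz_on {m..} inverse"
proof (rule lipschitz_on_of_deriv_bound[where f' = "\<lambda>x. - (1 / x\<^sup>2)"])
  fix x :: real assume "x \<in> {m..}"
  then have x: "x \<ge> m" by simp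
  then show "\<bar>- (1 / x\<^sup>2)\<bar> \<le> 1 / m\<^sup>2"
    using assms by (simp add: field_simps)
  show "(inverse has_real_derivative - (1 / x\<^sup>2)) (at x within {m..})"
    using x assms by (auto intro!: derivative_eq_intros simp: power2_eq_square field_simps)
qed (use assms in auto)

lemma lipschitz_on_ln:
  fixes m :: real assumes "m > 0" shows "(1 / m)-lipschitz_on {m..} ln"
  by (rule lipschitz_on_of_deriv_bound[where f' = "\<lambda>x. 1 / x"])
     (use assms in \<open>auto intro!: derivative_eq_intros simp: field_simps\<close>)

lemma lipschitz_on_exp:
  fixes M :: real shows "(exp M)-lipschitz_on {..M} (exp :: real \<Rightarrow> real)"
  by (rule lipschitz_on_of_deriv_bound[where f' = "exp"]) (auto intro!: derivative_eq_intros)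

text \<open>Hoelder bounds glue along a common endpoint because the distances to that endpoint are at
  most the distance of the two points.\<close>
lemma holder_on_Icc_join:
  assumes "holder_on \<alpha> {a..b} f" "holder_on \<alpha> {b..c} f" "\<alpha> \<ge> 0"
  shows "holder_on \<alpha> {a..c} f"
proof -
  obtain C where C: "C \<ge> 0" "\<And>x y. x \<in> {a..b} \<Longrightarrow> y \<in> {a..b} \<Longrightarrow> \<bar>f x - f y\<bar> \<le> C * \<bar>x - y\<bar> powr \<alpha>"
    using assms(1) by (auto elim: holder_onE)
  obtain D where D: "D \<ge> 0" "\<And>x y. x \<in> {b..c} \<Longrightarrow> y \<in> {b..c} \<Longrightarrow> \<bar>f x - f y\<bar> \<le> D * \<bar>x - y\<bar> powr \<alpha>"
    using assms(2) by (auto elim: holder_onE)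
  have *: "\<bar>f x - f y\<bar> \<le> (C + D) * \<bar>x - y\<bar> powr \<alpha>"
    if "x \<in> {a..c}" "y \<in> {a..c}" "x \<le> y" for x y
  proof -
    consider "y \<le> b" | "b \<le> x" | "x \<le> b" "b \<le> y" by linarith
    then show ?thesis
    proof cases
      case 1
      have "C * \<bar>x - y\<bar> powr \<alpha> \<le> (C + D) * \<bar>x - y\<bar> powr \<alpha>"
        using D(1) by (intro mult_right_mono) auto
      then show ?thesis using C(2)[of x y] that 1 by auto
    next
      case 2
      have "D * \<bar>x - y\<bar> powr \<alpha> \<le> (C + D) * \<bar>x - y\<bar> powr \<alpha>"
        using C(1) by (intro mult_right_mono) auto
      then show ?thesis using D(2)[of x y] that 2 by auto
    next
      case 3
      have "\<bar>f x - f b\<bar> \<le> C * \<bar>x - b\<bar> powr \<alpha>" "\<bar>f b - f y\<bar> \<le> D * \<bar>b - y\<bar> powr \<alpha>"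
        using that 3 by (intro C(2) D(2); simp)+
      moreover have "C * \<bar>x - b\<bar> powr \<alpha> \<le> C * \<bar>x - y\<bar> powr \<alpha>" "D * \<bar>b - y\<bar> powr \<alpha> \<le> D * \<bar>x - y\<bar> powr \<alpha>"
        using 3 assms(3) C(1) D(1) by (auto intro!: mult_left_mono powr_mono2)
      ultimately have "\<bar>f x - f y\<bar> \<le> C * \<bar>x - y\<bar> powr \<alpha> + D * \<bar>x - y\<bar> powr \<alpha>" by linarith
      then show ?thesis by (simp add: algebra_simps)
    qed
  qed
  show ?thesis
  proof (rule holder_onI)
    fix x y assume xy: "x \<in> {a..c}" "y \<in> {a..c}"
    show "\<bar>f x - f y\<bar> \<le> (C + D) * \<bar>x - y\<bar> powr \<alpha>"
      using *[OF xy] *[OF xy(2,1)] by (cases "x \<le> y") (auto simp: abs_minus_commute)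
  qed (use C D in auto)
qed

text \<open>One period suffices: two points can be moved by multiples of the period into two consecutive
  periods without increasing their distance.\<close>
lemma holder_on_periodic:
  assumes per: "\<And>x. f (x + p) = f x" and "p > 0" "\<alpha> \<ge> 0"
    and h: "holder_on \<alpha> {a..a + p} f"
  shows "holder_on \<alpha> UNIV f"
proof -
  have per_int: "f (x + of_int k * p) = f x" for x k
  proof (induction k rule: int_induct[where k = 0])
    case (step1 i)
    then show ?case using per[of "x + of_int i * p"] by (simp add: algebra_simps)
  next
    case (step2 i)
    then show ?case using per[of "x + of_int (i - 1) * p"] by (simp add: algebra_simps)
  qed auto
  have "holder_on \<alpha> {a + p..a + p + p} f"
  proof -
    obtain C where C: "C \<ge> 0" "\<And>x y. x \<in> {a..a+p} \<Longrightarrow> y \<in> {a..a+p} \<Longrightarrow> \<bar>f x - f y\<bar> \<le> C * \<bar>x - y\<bar> powr \<alpha>"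
      using h by (auto elim: holder_onE)
    show ?thesis
    proof (rule holder_onI)
      fix x y assume "x \<in> {a + p..a + p + p}" "y \<in> {a + p..a + p + p}"
      then show "\<bar>f x - f y\<bar> \<le> C * \<bar>x - y\<bar> powr \<alpha>"
        using C(2)[of "x - p" "y - p"] per[of "x - p"] per[of "y - p"] by auto
    qed fact
  qed
  then have "holder_on \<alpha> {a..a + p + p} f"
    using h assms(3) by (blast intro: holder_on_Icc_join)
  then obtain C where C: "C \<ge> 0" "\<And>x y. x \<in> {a..a+p+p} \<Longrightarrow> y \<in> {a..a+p+p} \<Longrightarrow> \<bar>f x - f y\<bar> \<le> C * \<bar>x - y\<bar> powr \<alpha>"
    by (auto elim: holder_onE)
  have *: "\<bar>f x - f y\<bar> \<le> C * \<bar>x - y\<bar> powr \<alpha>" if "x \<le> y" for x y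
  proof -
    define k where "k = \<lfloor>(x - a) / p\<rfloor>"
    define j where "j = \<lfloor>(y - x) / p\<rfloor>"
    have k: "of_int k * p \<le> x - a" "x - a < (of_int k + 1) * p"
      unfolding k_def using \<open>p > 0\<close> by (auto intro: floor_divide_lower floor_divide_upper)
    have j: "of_int j * p \<le> y - x" "y - x < (of_int j + 1) * p"
      unfolding j_def using \<open>p > 0\<close> by (auto intro: floor_divide_lower floor_divide_upper)
    have "j \<ge> 0" using that \<open>p > 0\<close> by (simp add: j_def)
    define x' where "x' = x + of_int (- k) * p"
    define y' where "y' = y + of_int (- k - j) * p"
    have "x' \<in> {a..a+p+p}" "y' \<in> {a..a+p+p}" "x' \<le> y'"
      using k j \<open>p > 0\<close> by (auto simp: x'_def y'_def algebra_simps)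
    moreover have "\<bar>x' - y'\<bar> \<le> \<bar>x - y\<bar>"
    proof -
      have "y' - x' = y - x - of_int j * p" by (simp add: x'_def y'_def algebra_simps)
      moreover have "of_int j * p \<ge> 0" using \<open>j \<ge> 0\<close> \<open>p > 0\<close> by simp
      ultimately show ?thesis using \<open>x' \<le> y'\<close> by linarith
    qed
    ultimately have "\<bar>f x' - f y'\<bar> \<le> C * \<bar>x - y\<bar> powr \<alpha>"
      by (intro order_trans[OF C(2)] mult_left_mono powr_mono2) (use C(1) assms(3) in auto)
    then show ?thesis unfolding x'_def y'_def per_int .
  qed
  show ?thesis
  proof (rule holder_onI)
    fix x y show "\<bar>f x - f y\<bar> \<le> C * \<bar>x - y\<bar> powr \<alpha>"
      using *[of x y] *[of y x] by (cases "x \<le> y") (auto simp: abs_minus_commute)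
  qed (use C in auto)
qed

lemma lipschitz_on_imp_holder_on:
  assumes "K-lipschitz_on {a..b} f" "0 < \<alpha>" "\<alpha> \<le> 1"
  shows "holder_on \<alpha> {a..b} f"
proof (rule holder_onI)
  fix x y assume xy: "x \<in> {a..b}" "y \<in> {a..b}"
  have K: "K \<ge> 0" using assms(1) lipschitz_on_def by blast
  have "\<bar>f x - f y\<bar> \<le> K * \<bar>x - y\<bar>"
    using lipschitz_onD[OF assms(1) xy] by (simp add: dist_real_def)
  also have "\<bar>x - y\<bar> = \<bar>x - y\<bar> powr (1 - \<alpha>) * \<bar>x - y\<bar> powr \<alpha>"
    by (cases "x = y") (auto simp flip: powr_add)
  also have "K * \<dots> \<le> K * ((b - a) powr (1 - \<alpha>) * \<bar>x - y\<bar> powr \<alpha>)"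
    using xy assms K by (intro mult_left_mono mult_right_mono powr_mono2) auto
  finally show "\<bar>f x - f y\<bar> \<le> K * (b - a) powr (1 - \<alpha>) * \<bar>x - y\<bar> powr \<alpha>"
    by (simp add: mult.assoc)
next
  show "K * (b - a) powr (1 - \<alpha>) \<ge> 0"
    using assms(1) lipschitz_on_def by (auto intro!: mult_nonneg_nonneg)
qed

section \<open>Maps with positive Hoelder derivative\<close>

text \<open>The derivative is two-sided at every point of the set, also at an endpoint of an interval;
  only its Hoelder bound is relative to the set.  In this form neighbouring intervals can be glued.\<close>
definition holder_diffeo_on :: "real \<Rightarrow> real set \<Rightarrow> (real \<Rightarrow> real) \<Rightarrow> bool" where
  "holder_diffeo_on \<alpha> S f \<longleftrightarrow>
     (\<exists>f'. (\<forall>x\<in>S. (f has_real_derivative f' x) (at x) \<and> f' x > 0) \<and> holder_on \<alpha> S f')"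

lemma holder_diffeo_onE:
  assumes "holder_diffeo_on \<alpha> S f"
  obtains f' where "\<And>x. x \<in> S \<Longrightarrow> (f has_real_derivative f' x) (at x)" "\<And>x. x \<in> S \<Longrightarrow> f' x > 0"
    "holder_on \<alpha> S f'"
  using assms unfolding holder_diffeo_on_def by blast

lemma holder_diffeo_on_subset: "holder_diffeo_on \<alpha> S f \<Longrightarrow> T \<subseteq> S \<Longrightarrow> holder_diffeo_on \<alpha> T f"
  unfolding holder_diffeo_on_def by (meson holder_on_subset subsetD)

lemma compact_positive_bounds:
  fixes f :: "real \<Rightarrow> real"
  assumes "continuous_on S f" "compact S" "\<And>x. x \<in> S \<Longrightarrow> f x > 0"
  obtains m M where "m > 0" "M \<ge> 0" "\<And>x. x \<in> S \<Longrightarrow> m \<le> f x" "\<And>x. x \<in> S \<Longrightarrow> f x \<le> M"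
proof (cases "S = {}")
  case True then show ?thesis using that[of 1 1] by auto
next
  case False
  obtain l where l: "l \<in> S" "\<forall>x\<in>S. f l \<le> f x" 
    using continuous_attains_inf[OF assms(2) False assms(1)] by auto
  obtain u where u: "u \<in> S" "\<forall>x\<in>S. f x \<le> f u" 
    using continuous_attains_sup[OF assms(2) False assms(1)] by auto
  show ?thesis using that[of "f l" "f u"] l u assms(3) by (auto simp: less_imp_le)
qed

lemma holder_diffeo_on_compose:
  assumes g: "holder_diffeo_on \<alpha> {a..b} g" and f: "holder_diffeo_on \<alpha> T f" and gT: "g ` {a..b} \<subseteq> T"
    and \<alpha>: "\<alpha> > 0"
  shows "holder_diffeo_on \<alpha> {a..b} (\<lambda>x. f (g x))"
proof -
  obtain f' where f': "\<And>x. x \<in> T \<Longrightarrow> (f has_real_derivative f' x) (at x)" "\<And>x. x \<in> T \<Longrightarrow> f' x > 0"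
    "holder_on \<alpha> T f'" using f by (rule holder_diffeo_onE) blast
  obtain g' where g': "\<And>x. x \<in> {a..b} \<Longrightarrow> (g has_real_derivative g' x) (at x)" 
    "\<And>x. x \<in> {a..b} \<Longrightarrow> g' x > 0" "holder_on \<alpha> {a..b} g'" using g by (rule holder_diffeo_onE) blast
  have cg: "continuous_on {a..b} g"
    by (intro continuous_at_imp_continuous_on) (use g'(1) DERIV_isCont in blast)
  have cg': "continuous_on {a..b} g'" using g'(3) \<alpha> by (rule holder_on_imp_continuous_on)
  have cfg: "continuous_on {a..b} (\<lambda>x. f' (g x))"
    by (rule continuous_on_compose2[OF holder_on_imp_continuous_on[OF f'(3) \<alpha>] cg gT])
  obtain m M where M: "M \<ge> 0" "\<And>x. x \<in> {a..b} \<Longrightarrow> g' x \<le> M"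
    using compact_positive_bounds[OF cg' compact_Icc g'(2)] by metis
  have fpos: "f' (g x) > 0" if "x \<in> {a..b}" for x using f'(2) gT that by blast
  obtain m1 M1 where M1: "M1 \<ge> 0" "\<And>x. x \<in> {a..b} \<Longrightarrow> f' (g x) \<le> M1"
    using compact_positive_bounds[OF cfg compact_Icc fpos] by metis
  have lip: "M-lipschitz_on {a..b} g"
    by (rule lipschitz_on_of_deriv_bound[where f' = g'])
       (use M g' in \<open>auto intro: has_field_derivative_at_within simp: abs_if less_le_not_le\<close>)
  have "holder_on \<alpha> {a..b} (\<lambda>x. f' (g x) * g' x)"
    by (rule holder_on_mult[where A = M1 and B = M, OF holder_on_compose_lipschitz[OF f'(3) _ lip gT] g'(3)])
       (use M M1 g'(2) fpos \<alpha> in \<open>auto simp: abs_if less_le_not_le\<close>)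
  moreover have "((\<lambda>x. f (g x)) has_real_derivative f' (g x) * g' x) (at x)" if "x \<in> {a..b}" for x
    using DERIV_chain2[OF f'(1) g'(1)] gT that by blast
  ultimately show ?thesis unfolding holder_diffeo_on_def
    using fpos g'(2) by (intro exI[of _ "\<lambda>x. f' (g x) * g' x"]) auto
qed

text \<open>The inverse function rule in a form that needs no inverse function: if \<open>H \<circ> F\<close> and \<open>H\<close> are
  differentiable, then so is \<open>F\<close>.\<close>
lemma has_real_derivative_cancel_left:
  fixes F H K :: "real \<Rightarrow> real"
  assumes K: "(K has_real_derivative k) (at v)" and H: "(H has_real_derivative h) (at (F v))" and "h \<noteq> 0"
    and F: "isCont F v" and inj: "inj F" and eq: "\<forall>\<^sub>F w in nhds v. H (F w) = K w"
  shows "(F has_real_derivative k / h) (at v)"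
proof -
  have FF: "filterlim F (at (F v)) (at v)"
    unfolding filterlim_at using F inj
    by (auto simp: isCont_def eventually_at_filter inj_eq)
  have "((\<lambda>y. (H y - H (F v)) / (y - F v)) \<longlongrightarrow> h) (at (F v))"
    using H by (simp add: has_field_derivative_iff)
  from filterlim_compose[OF this FF]
  have quot: "((\<lambda>w. (H (F w) - H (F v)) / (F w - F v)) \<longlongrightarrow> h) (at v)" .
  from quot have nz: "\<forall>\<^sub>F w in at v. (H (F w) - H (F v)) / (F w - F v) \<noteq> 0"
    using \<open>h \<noteq> 0\<close> by (rule tendsto_imp_eventually_ne)
  have "((\<lambda>w. (K w - K v) / (w - v)) \<longlongrightarrow> k) (at v)"
    using K by (simp add: has_field_derivative_iff)
  from this quot have lim: "((\<lambda>w. ((K w - K v) / (w - v)) / ((H (F w) - H (F v)) / (F w - F v))) \<longlongrightarrow> k / h) (at v)"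
    using \<open>h \<noteq> 0\<close> by (intro tendsto_divide)
  have eqv: "H (F v) = K v" using eq by (rule eventually_nhds_x_imp_x)
  have "\<forall>\<^sub>F w in at v. ((K w - K v) / (w - v)) / ((H (F w) - H (F v)) / (F w - F v)) = (F w - F v) / (w - v)"
    using nz eq[unfolded eventually_nhds_conv_at, THEN conjunct1]
  proof eventually_elim
    case (elim w)
    then have "K w - K v \<noteq> 0" "F w - F v \<noteq> 0" using eqv by auto
    moreover have "(A / B) / (A / D) = D / B" if "A \<noteq> 0" for A B D :: real
      using that by simp
    ultimately show ?case using elim eqv by simp
  qed
  then show ?thesis unfolding has_field_derivative_iff
    using lim by (rule Lim_transform_eventually[rotated])
qed

text \<open>The tool that transfers regularity to a conjugacy: \<open>F\<close> itself is only known to be a continuous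
  injection, but \<open>H \<circ> F = K\<close> forces \<open>F' = K' / (H' \<circ> F)\<close>.  Boundedness of this quotient makes \<open>F\<close>
  Lipschitz, after which the quotient is Hoelder.\<close>
lemma holder_diffeo_on_cancel_left:
  assumes K: "holder_diffeo_on \<alpha> {a..b} K" and H: "holder_diffeo_on \<alpha> T H" and FT: "F ` {a..b} \<subseteq> T"
    and F: "continuous_on UNIV F" "inj F" and \<alpha>: "\<alpha> > 0"
    and U: "open U" "{a..b} \<subseteq> U" "\<And>v. v \<in> U \<Longrightarrow> H (F v) = K v"
  shows "holder_diffeo_on \<alpha> {a..b} F"
proof -
  obtain H' where H': "\<And>x. x \<in> T \<Longrightarrow> (H has_real_derivative H' x) (at x)" "\<And>x. x \<in> T \<Longrightarrow> H' x > 0"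
    "holder_on \<alpha> T H'" using H by (rule holder_diffeo_onE) blast
  obtain K' where K': "\<And>x. x \<in> {a..b} \<Longrightarrow> (K has_real_derivative K' x) (at x)" 
    "\<And>x. x \<in> {a..b} \<Longrightarrow> K' x > 0" "holder_on \<alpha> {a..b} K'" using K by (rule holder_diffeo_onE) blast
  have cK': "continuous_on {a..b} K'" using K'(3) \<alpha> by (rule holder_on_imp_continuous_on)
  have cH: "continuous_on {a..b} (\<lambda>x. H' (F x))"
    by (rule continuous_on_compose2[OF holder_on_imp_continuous_on[OF H'(3) \<alpha>] _ FT])
       (use F continuous_on_subset in blast)
  obtain m M where M: "M \<ge> 0" "\<And>x. x \<in> {a..b} \<Longrightarrow> K' x \<le> M"
    using compact_positive_bounds[OF cK' compact_Icc K'(2)] by metis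
  have Hpos: "H' (F x) > 0" if "x \<in> {a..b}" for x using H'(2) FT that by blast
  obtain m1 M1 where m1: "m1 > 0" "\<And>x. x \<in> {a..b} \<Longrightarrow> m1 \<le> H' (F x)"
    using compact_positive_bounds[OF cH compact_Icc Hpos] by metis
  have der: "(F has_real_derivative K' v * inverse (H' (F v))) (at v)" if "v \<in> {a..b}" for v
  proof -
    have "\<forall>\<^sub>F w in nhds v. H (F w) = K w"
      unfolding eventually_nhds using U that by (intro exI[of _ U]) blast
    moreover have "F v \<in> T" using FT that by blast
    ultimately have "(F has_real_derivative K' v / H' (F v)) (at v)"
      using has_real_derivative_cancel_left[of K "K' v" v H "H' (F v)" F]
        K'(1)[OF that] H'(1)[OF \<open>F v \<in> T\<close>] F Hpos[OF that] by (auto simp: continuous_on_eq_continuous_at)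
    then show ?thesis by (simp add: divide_inverse)
  qed
  have inv_bd: "inverse (H' (F x)) \<le> inverse m1" if "x \<in> {a..b}" for x
    using m1 that by (intro le_imp_inverse_le) auto
  have lip: "(M * inverse m1)-lipschitz_on {a..b} F"
  proof (rule lipschitz_on_of_deriv_bound[where f' = "\<lambda>v. K' v * inverse (H' (F v))"])
    fix x assume x: "x \<in> {a..b}"
    show "\<bar>K' x * inverse (H' (F x))\<bar> \<le> M * inverse m1"
      unfolding abs_mult
      using M(2)[OF x] K'(2)[OF x] Hpos[OF x] m1(1) inv_bd[OF x] M(1) by (intro mult_mono) auto
  qed (use der M m1 in \<open>auto intro: has_field_derivative_at_within\<close>)
  have "holder_on \<alpha> {a..b} (\<lambda>x. H' (F x))"
    using holder_on_compose_lipschitz[OF H'(3) _ lip FT] \<alpha> by simp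
  then have "holder_on \<alpha> {a..b} (\<lambda>x. inverse (H' (F x)))"
    by (rule lipschitz_compose_holder_on[OF _ lipschitz_on_inverse[OF m1(1)]]) (use m1 in auto)
  then have "holder_on \<alpha> {a..b} (\<lambda>x. K' x * inverse (H' (F x)))"
    by (rule holder_on_mult[where A = M and B = "inverse m1", OF K'(3)])
       (use M K'(2) inv_bd Hpos in \<open>auto simp: abs_if less_le_not_le\<close>)
  then show ?thesis unfolding holder_diffeo_on_def
    using der K'(2) Hpos by (intro exI[of _ "\<lambda>x. K' x * inverse (H' (F x))"]) auto
qed

lemma holder_diffeo_on_cong_open:
  assumes "holder_diffeo_on \<alpha> S f" "open U" "S \<subseteq> U" "\<And>x. x \<in> U \<Longrightarrow> f x = g x"
  shows "holder_diffeo_on \<alpha> S g"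
proof -
  obtain f' where f': "\<And>x. x \<in> S \<Longrightarrow> (f has_real_derivative f' x) (at x)" "\<And>x. x \<in> S \<Longrightarrow> f' x > 0"
    "holder_on \<alpha> S f'" using assms(1) by (rule holder_diffeo_onE) blast
  have "(g has_real_derivative f' x) (at x)" if "x \<in> S" for x
    using has_field_derivative_transform_within_open[OF f'(1)[OF that] assms(2)] that assms(3,4) by blast
  then show ?thesis unfolding holder_diffeo_on_def using f' by blast
qed

text \<open>An induction principle for properties of real numbers that are invariant under a translation.\<close>
lemma shift_induct_real:
  fixes a p y :: real
  assumes "p > 0" and up: "\<And>x. P x \<Longrightarrow> P (x + p)" and down: "\<And>x. P x \<Longrightarrow> P (x - p)"
    and base: "\<And>x. x \<in> {a..a + p} \<Longrightarrow> P x"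
  shows "P y"
proof -
  have shift: "P (x + of_int k * p)" if "P x" for x k
  proof (induction k rule: int_induct[where k = 0])
    case (step1 i)
    then show ?case using up[of "x + of_int i * p"] by (simp add: algebra_simps)
  next
    case (step2 i)
    then show ?case using down[of "x + of_int i * p"] by (simp add: algebra_simps)
  qed (use that in auto)
  define k where "k = \<lfloor>(y - a) / p\<rfloor>"
  have "of_int k * p \<le> y - a" "y - a < (of_int k + 1) * p"
    unfolding k_def using \<open>p > 0\<close> by (auto intro: floor_divide_lower floor_divide_upper)
  then have "P (y - of_int k * p)" by (intro base) (auto simp: algebra_simps)
  then show ?thesis using shift[of "y - of_int k * p" k] by simp
qed

lemma holder_diffeo_on_periodic:
  assumes per: "\<And>x. f (x + p) = f x + c" and "p > 0" "\<alpha> \<ge> 0"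
    and l: "holder_diffeo_on \<alpha> {a..b} f" and r: "holder_diffeo_on \<alpha> {b..a + p} f"
  shows "holder_diffeo_on \<alpha> UNIV f"
proof -
  obtain fl where fl: "\<And>x. x \<in> {a..b} \<Longrightarrow> (f has_real_derivative fl x) (at x)" "\<And>x. x \<in> {a..b} \<Longrightarrow> fl x > 0"
    "holder_on \<alpha> {a..b} fl" using l by (rule holder_diffeo_onE) blast
  obtain fr where fr: "\<And>x. x \<in> {b..a + p} \<Longrightarrow> (f has_real_derivative fr x) (at x)" "\<And>x. x \<in> {b..a + p} \<Longrightarrow> fr x > 0"
    "holder_on \<alpha> {b..a + p} fr" using r by (rule holder_diffeo_onE) blast
  have up: "(f has_real_derivative D) (at (x + p))" if "(f has_real_derivative D) (at x)" for x D
  proof -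
    have "f y = f (y - p) + c" for y using per[of "y - p"] by simp
    then have "f = (\<lambda>y. f (y - p) + c)" by (rule ext)
    moreover have "((\<lambda>y. f (y - p) + c) has_real_derivative D) (at (x + p))"
      using that DERIV_shift[of f D "x + p" "- p"] by (auto intro!: derivative_eq_intros)
    ultimately show ?thesis by argo
  qed
  have down: "(f has_real_derivative D) (at (x - p))" if "(f has_real_derivative D) (at x)" for x D
  proof -
    have "((\<lambda>y. f (y + p) - c) has_real_derivative D) (at (x - p))"
      using that DERIV_shift[of f D "x - p" p] by (auto intro!: derivative_eq_intros)
    then show ?thesis using per by simp
  qed
  have "\<exists>D>0. (f has_real_derivative D) (at x)" for x
  proof (rule shift_induct_real[OF \<open>p > 0\<close>, where a = a and P = "\<lambda>x. \<exists>D>0. (f has_real_derivative D) (at x)"])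
    fix x assume "x \<in> {a..a + p}"
    then show "\<exists>D>0. (f has_real_derivative D) (at x)"
      using fl(1,2)[of x] fr(1,2)[of x] by (cases "x \<le> b") auto
  next
    fix x assume "\<exists>D>0. (f has_real_derivative D) (at x)"
    then show "\<exists>D>0. (f has_real_derivative D) (at (x + p))" "\<exists>D>0. (f has_real_derivative D) (at (x - p))"
      using up[of _ x] down[of _ x] by blast+
  qed
  then have der: "(f has_real_derivative deriv f x) (at x)" "deriv f x > 0" for x
    by (metis DERIV_imp_deriv)+
  have "holder_on \<alpha> {a..b} (deriv f)" "holder_on \<alpha> {b..a + p} (deriv f)"
    by (rule holder_on_cong[OF fl(3)] holder_on_cong[OF fr(3)], metis fl(1) fr(1) DERIV_imp_deriv)+
  then have "holder_on \<alpha> {a..a + p} (deriv f)" using \<open>\<alpha> \<ge> 0\<close> by (rule holder_on_Icc_join)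
  then have "holder_on \<alpha> UNIV (deriv f)"
    using \<open>p > 0\<close> \<open>\<alpha> \<ge> 0\<close> by (intro holder_on_periodic[of "deriv f" p]) (auto intro: DERIV_imp_deriv up der)
  then show ?thesis unfolding holder_diffeo_on_def using der by blast
qed

section \<open>Linearization at an attracting fixed point\<close>

text \<open>Sternberg's linearization theorem in one variable.  The chain rule turns \<open>h (G x) = \<mu> h x\<close> into
  a cohomological equation for \<open>L = ln h'\<close>, namely \<open>L x = ln (G' x / \<mu>) + L (G x)\<close>, which is solved by
  a series along the orbit of \<open>x\<close>.  The series converges because \<open>ln G'\<close> is Hoelder and the orbit
  approaches the fixed point geometrically.\<close>
lemma Sternberg_linearization:
  fixes G :: "real \<Rightarrow> real"
  assumes G: "holder_diffeo_on \<alpha> UNIV G" and Gq: "G q = q" and D: "(G has_real_derivative \<mu>) (at q)"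
    and "\<mu> < 1" and \<alpha>: "\<alpha> > 0"
  obtains \<delta> h where "\<delta> > 0" "holder_diffeo_on \<alpha> (ball q \<delta>) h" "h q = 0"
    "\<And>x. x \<in> ball q \<delta> \<Longrightarrow> G x \<in> ball q \<delta>" "\<And>x. x \<in> ball q \<delta> \<Longrightarrow> h (G x) = \<mu> * h x"
proof -
  obtain G' where G': "\<And>x. (G has_real_derivative G' x) (at x)" "\<And>x. G' x > 0" "holder_on \<alpha> UNIV G'"
    by (rule holder_diffeo_onE[OF G]) blast
  have \<mu>: "G' q = \<mu>" "\<mu> > 0"
    using DERIV_unique[OF G'(1) D] G'(2)[of q] by auto
  have contG': "continuous_on UNIV G'" using G'(3) \<alpha> by (rule holder_on_imp_continuous_on)
  define \<kappa> where "\<kappa> = (1 + \<mu>) / 2"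
  have \<kappa>: "\<mu> < \<kappa>" "0 < \<kappa>" "\<kappa> < 1" using \<open>\<mu> < 1\<close> \<mu>(2) by (auto simp: \<kappa>_def)
  have "isCont G' q" using contG' by (simp add: continuous_on_eq_continuous_at)
  then have "\<forall>\<^sub>F x in nhds q. G' x < \<kappa>"
    unfolding isCont_def eventually_nhds_conv_at
    using order_tendstoD(2)[of G' "G' q" "at q" \<kappa>] \<kappa>(1) \<mu>(1) by simp
  then obtain \<delta>0 where \<delta>0: "\<delta>0 > 0" "\<And>x. dist x q < \<delta>0 \<Longrightarrow> G' x < \<kappa>"
    unfolding eventually_nhds_metric by blast
  \<comment> \<open>Halving the radius makes the bound on the derivative available on the closed interval \<open>J\<close>.\<close>
  define \<delta> where "\<delta> = \<delta>0 / 2"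
  define J where "J = {q - \<delta>..q + \<delta>}"
  have \<delta>: "\<delta> > 0" using \<delta>0(1) by (simp add: \<delta>_def)
  have J: "x \<in> J \<longleftrightarrow> \<bar>x - q\<bar> \<le> \<delta>" for x by (auto simp: J_def)
  have B: "x \<in> ball q \<delta> \<longleftrightarrow> \<bar>x - q\<bar> < \<delta>" for x by (auto simp: dist_real_def)
  have qJ: "q \<in> J" using \<delta> by (simp add: J)
  have G'\<kappa>: "\<bar>G' x\<bar> \<le> \<kappa>" if "x \<in> J" for x
    using \<delta>0(2)[of x] G'(2)[of x] \<delta>0(1) that by (auto simp: J dist_real_def \<delta>_def)
  have lipG: "\<bar>G x - G y\<bar> \<le> \<kappa> * \<bar>x - y\<bar>" if "x \<in> J" "y \<in> J" for x y
  proof -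
    have "\<kappa>-lipschitz_on J G"
      by (rule lipschitz_on_of_deriv_bound[where f' = G'])
         (use G'\<kappa> \<kappa> G'(1) in \<open>auto intro: has_field_derivative_at_within simp: J_def\<close>)
    then show ?thesis using lipschitz_onD[of \<kappa> J G x y] that by (simp add: dist_real_def)
  qed
  have shrink: "\<bar>G x - q\<bar> \<le> \<bar>x - q\<bar>" if "x \<in> J" for x
  proof -
    have "\<bar>G x - q\<bar> \<le> \<kappa> * \<bar>x - q\<bar>" using lipG[OF that qJ] Gq by simp
    also have "\<dots> \<le> 1 * \<bar>x - q\<bar>" using \<kappa> by (intro mult_right_mono) auto
    finally show ?thesis by simp
  qed
  have GJ: "G x \<in> J" if "x \<in> J" for x
    using shrink[OF that] that by (simp add: J)
  have GB: "G x \<in> ball q \<delta>" if "x \<in> ball q \<delta>" for x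
    using shrink[of x, unfolded J] that unfolding B by simp
  have iter: "(G ^^ k) x \<in> J \<and> (G ^^ k) y \<in> J \<and> \<bar>(G ^^ k) x - (G ^^ k) y\<bar> \<le> \<kappa> ^ k * \<bar>x - y\<bar>"
    if "x \<in> J" "y \<in> J" for x y k
  proof (induction k)
    case (Suc k)
    then have "\<bar>(G ^^ Suc k) x - (G ^^ Suc k) y\<bar> \<le> \<kappa> * \<bar>(G ^^ k) x - (G ^^ k) y\<bar>"
      using lipG by simp
    also have "\<dots> \<le> \<kappa> * (\<kappa> ^ k * \<bar>x - y\<bar>)" using Suc \<kappa> by (intro mult_left_mono) auto
    finally show ?case using Suc GJ by simp
  qed (use that in auto)
  have iterq: "(G ^^ k) q = q" for k by (induction k) (auto simp: Gq)
  define l where "l x = ln (G' x) - ln \<mu>" for x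
  obtain m where m: "m > 0" "\<And>x. x \<in> J \<Longrightarrow> m \<le> G' x"
    using compact_positive_bounds[of J G'] contG' G'(2) continuous_on_subset
    by (metis J_def compact_Icc top_greatest)
  have "holder_on \<alpha> J (\<lambda>x. ln (G' x))"
    by (rule lipschitz_compose_holder_on[OF holder_on_subset[OF G'(3)] lipschitz_on_ln[OF m(1)]])
       (use m in auto)
  then obtain c where c: "c \<ge> 0" "\<And>x y. x \<in> J \<Longrightarrow> y \<in> J \<Longrightarrow> \<bar>l x - l y\<bar> \<le> c * \<bar>x - y\<bar> powr \<alpha>"
    by (elim holder_onE) (simp add: l_def)
  \<comment> \<open>\<open>\<theta>\<close> is the rate at which the terms of the series decay when orbits contract at rate \<open>\<kappa>\<close>.\<close>
  define \<theta> where "\<theta> = \<kappa> powr \<alpha>"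
  have \<theta>: "0 < \<theta>" "\<theta> < 1" using \<kappa> \<alpha> by (auto simp: \<theta>_def powr01_less_one)
  have lbound: "\<bar>l ((G ^^ k) x) - l ((G ^^ k) y)\<bar> \<le> c * \<bar>x - y\<bar> powr \<alpha> * \<theta> ^ k"
    if "x \<in> J" "y \<in> J" for x y k
  proof -
    have "\<bar>l ((G ^^ k) x) - l ((G ^^ k) y)\<bar> \<le> c * \<bar>(G ^^ k) x - (G ^^ k) y\<bar> powr \<alpha>"
      using iter[OF that] by (intro c) auto
    also have "\<dots> \<le> c * (\<kappa> ^ k * \<bar>x - y\<bar>) powr \<alpha>"
      using iter[OF that] c(1) \<alpha> by (intro mult_left_mono powr_mono2) auto
    also have "(\<kappa> ^ k * \<bar>x - y\<bar>) powr \<alpha> = \<theta> ^ k * \<bar>x - y\<bar> powr \<alpha>"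
      using \<kappa> by (simp add: powr_mult \<theta>_def powr_power powr_powr mult.commute flip: powr_realpow)
    finally show ?thesis by (simp add: mult_ac)
  qed
  have lq: "l q = 0" by (simp add: l_def \<mu>)
  have sumgeo: "summable (\<lambda>k. C * \<theta> ^ k)" for C
    using \<theta> by (intro summable_mult summable_geometric) auto
  have summ: "summable (\<lambda>k. l ((G ^^ k) x))" if "x \<in> J" for x
    by (rule summable_comparison_test'[OF sumgeo[of "c * \<bar>x - q\<bar> powr \<alpha>"], of 0])
       (use lbound[OF that qJ] in \<open>simp add: iterq lq\<close>)
  define L where "L x = (\<Sum>k. l ((G ^^ k) x))" for x
  have Lstep: "L x = l x + L (G x)" if "x \<in> J" for x
    using suminf_split_head[OF summ[OF that]] by (simp add: L_def funpow_swap1)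
  have Lholder: "\<bar>L x - L y\<bar> \<le> c / (1 - \<theta>) * \<bar>x - y\<bar> powr \<alpha>" if "x \<in> J" "y \<in> J" for x y
  proof -
    have "L x - L y = (\<Sum>k. l ((G ^^ k) x) - l ((G ^^ k) y))"
      unfolding L_def using that by (intro suminf_diff summ)
    also have "\<bar>\<dots>\<bar> \<le> (\<Sum>k. c * \<bar>x - y\<bar> powr \<alpha> * \<theta> ^ k)"
      using lbound[OF that] sumgeo by (intro norm_suminf_le[where 'a = real, unfolded real_norm_def]) auto
    also have "\<dots> = c * \<bar>x - y\<bar> powr \<alpha> * (1 / (1 - \<theta>))"
      using \<theta> by (subst suminf_mult) (auto simp: suminf_geometric)
    finally show ?thesis by simp
  qed
  have Lq: "L q = 0" by (simp add: L_def iterq lq)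
  have holderL: "holder_on \<alpha> J L"
    using c(1) \<theta> by (intro holder_onI[OF Lholder]) auto
  have Lbd: "L x \<le> c / (1 - \<theta>) * \<delta> powr \<alpha>" if "x \<in> J" for x
  proof -
    have "\<bar>L x\<bar> \<le> c / (1 - \<theta>) * \<bar>x - q\<bar> powr \<alpha>" using Lholder[OF that qJ] Lq by simp
    also have "\<dots> \<le> c / (1 - \<theta>) * \<delta> powr \<alpha>"
      using that c(1) \<theta> \<alpha> by (intro mult_left_mono powr_mono2) (auto simp: J)
    finally show ?thesis by simp
  qed
  have holderE: "holder_on \<alpha> J (\<lambda>x. exp (L x))"
    by (rule lipschitz_compose_holder_on[OF holderL lipschitz_on_exp]) (use Lbd in auto)
  have "continuous_on {q - \<delta>..q + \<delta>} (\<lambda>x. exp (L x))"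
    using holder_on_imp_continuous_on[OF holderE \<alpha>] by (simp add: J_def)
  then obtain h0 where h0: "\<And>x. x \<in> {q - \<delta>..q + \<delta>} \<Longrightarrow>
      (h0 has_vector_derivative exp (L x)) (at x within {q - \<delta>..q + \<delta>})"
    using antiderivative_continuous by blast
  define h where "h x = h0 x - h0 q" for x
  have BJ: "ball q \<delta> \<subseteq> J" by (auto simp: J_def dist_real_def)
  have h: "(h has_real_derivative exp (L x)) (at x)" if "x \<in> ball q \<delta>" for x
  proof -
    have "(h0 has_real_derivative exp (L x)) (at x within {q - \<delta>..q + \<delta>})"
      using h0[of x] subsetD[OF BJ that] by (simp add: J_def has_real_derivative_iff_has_vector_derivative)
    moreover have "at x within {q - \<delta>..q + \<delta>} = at x"
      using that by (intro at_within_interior) (auto simp: dist_real_def)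
    ultimately show ?thesis unfolding h_def by (auto intro!: derivative_eq_intros)
  qed
  have hol: "holder_diffeo_on \<alpha> (ball q \<delta>) h"
    unfolding holder_diffeo_on_def using h BJ holder_on_subset[OF holderE, of "ball q \<delta>"]
    by (intro exI[of _ "\<lambda>x. exp (L x)"]) auto
  have hq: "h q = 0" by (simp add: h_def)
  have "h (G x) = \<mu> * h x" if x: "x \<in> ball q \<delta>" for x
  proof -
    have "((\<lambda>x. h (G x) - \<mu> * h x) has_real_derivative 0) (at x)" if x: "x \<in> ball q \<delta>" for x
    proof -
      have xJ: "x \<in> J" using x[unfolded B] by (simp add: J)
      have "exp (L x) = (G' x / \<mu>) * exp (L (G x))"
        using G'(2)[of x] \<mu>(2) by (simp add: Lstep[OF xJ] exp_add l_def exp_diff)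
      then have "exp (L (G x)) * G' x - \<mu> * exp (L x) = 0"
        using \<mu>(2) by (simp add: field_simps)
      then show ?thesis
        using DERIV_diff[OF DERIV_chain2[OF h[OF GB[OF x]] G'(1)] DERIV_cmult[OF h[OF x], of \<mu>]] by simp
    qed
    then have "(\<lambda>x. h (G x) - \<mu> * h x) constant_on ball q \<delta>"
      by (intro has_field_derivative_0_imp_constant_on) auto
    then obtain k where k: "\<And>x. x \<in> ball q \<delta> \<Longrightarrow> h (G x) - \<mu> * h x = k"
      unfolding constant_on_def by blast
    have "k = 0" using k[of q] \<delta> by (simp add: Gq hq)
    then show ?thesis using k[OF x] by simp
  qed
  then show ?thesis using that[of \<delta> h] \<delta> hol hq GB by blast
qed

section \<open>Symmetric conjugacies from a linear contraction\<close>

text \<open>Jensen's functional equation on an interval.  The defect \<open>D\<close> from the affine interpolation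
  vanishes at both ends and satisfies the same equation.  Reflecting the nearer end in a point where
  \<open>\<bar>D\<bar>\<close> is maximal gives a point where \<open>\<bar>D\<bar>\<close> is twice as large, so the maximum is zero.\<close>
lemma midpoint_affine_continuous_imp_affine:
  fixes H :: "real \<Rightarrow> real"
  assumes cont: "continuous_on {a..b} H" and "a < b"
    and mid: "\<And>x t. 0 < t \<Longrightarrow> a \<le> x - t \<Longrightarrow> x + t \<le> b \<Longrightarrow> H (x + t) - H x = H x - H (x - t)"
    and x: "x \<in> {a..b}"
  shows "H x = H a + (H b - H a) / (b - a) * (x - a)"
proof -
  define k where "k = (H b - H a) / (b - a)"
  define D where "D x = H x - H a - k * (x - a)" for x
  have D0: "D a = 0" "D b = 0" using \<open>a < b\<close> by (auto simp: D_def k_def)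
  have Dmid: "D (x + t) + D (x - t) = 2 * D x" if "0 < t" "a \<le> x - t" "x + t \<le> b" for x t
    using mid[OF that] by (simp add: D_def algebra_simps)
  have "continuous_on {a..b} (\<lambda>x. \<bar>D x\<bar>)"
    unfolding D_def using cont by (intro continuous_intros)
  then obtain c where c: "c \<in> {a..b}" "\<And>y. y \<in> {a..b} \<Longrightarrow> \<bar>D y\<bar> \<le> \<bar>D c\<bar>"
    using continuous_attains_sup[of "{a..b}" "\<lambda>x. \<bar>D x\<bar>"] \<open>a < b\<close> by auto
  have "D c = 0"
  proof (rule ccontr)
    assume "D c \<noteq> 0"
    then have ab: "a < c" "c < b" using c(1) D0 by (auto simp: less_le)
    show False
    proof (cases "c - a \<le> b - c")
      case True
      have "D (c + (c - a)) + D (c - (c - a)) = 2 * D c"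
        using ab True by (intro Dmid) auto
      then have "D (c + (c - a)) = 2 * D c" using D0 by simp
      then show False using c(2)[of "c + (c - a)"] ab True \<open>D c \<noteq> 0\<close> by auto
    next
      case False
      have "D (c + (b - c)) + D (c - (b - c)) = 2 * D c"
        using ab False by (intro Dmid) auto
      then have "D (c - (b - c)) = 2 * D c" using D0 by simp
      then show False using c(2)[of "c - (b - c)"] ab False \<open>D c \<noteq> 0\<close> by auto
    qed
  qed
  then have "D x = 0" using c(2)[OF x] by simp
  then show ?thesis by (simp add: D_def k_def)
qed

text \<open>A continuously differentiable function is strictly differentiable.\<close>
lemma difference_quotients_tendsto:
  fixes h h' :: "real \<Rightarrow> real"
  assumes der: "\<And>x. x \<in> ball q \<delta> \<Longrightarrow> (h has_real_derivative h' x) (at x)" and "\<delta> > 0"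
    and cont: "isCont h' q" and a: "a \<longlonglongrightarrow> q" and b: "b \<longlonglongrightarrow> q"
    and less: "\<forall>\<^sub>F n in sequentially. a n < b n"
  shows "(\<lambda>n. (h (b n) - h (a n)) / (b n - a n)) \<longlonglongrightarrow> h' q"
proof (rule tendstoI)
  fix \<epsilon> :: real assume "\<epsilon> > 0"
  then have "\<forall>\<^sub>F x in at q. dist (h' x) (h' q) < \<epsilon>"
    using cont by (simp add: isCont_def tendstoD)
  then have "\<forall>\<^sub>F x in nhds q. dist (h' x) (h' q) < \<epsilon>"
    using \<open>\<epsilon> > 0\<close> by (simp add: eventually_nhds_conv_at)
  then obtain r0 where r0: "r0 > 0" "\<And>x. dist x q < r0 \<Longrightarrow> dist (h' x) (h' q) < \<epsilon>"
    unfolding eventually_nhds_metric by blast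
  define r where "r = min r0 \<delta>"
  have "r > 0" using r0(1) \<open>\<delta> > 0\<close> by (simp add: r_def)
  have "\<forall>\<^sub>F n in sequentially. dist (a n) q < r" "\<forall>\<^sub>F n in sequentially. dist (b n) q < r"
    using tendstoD[OF a \<open>r > 0\<close>] tendstoD[OF b \<open>r > 0\<close>] by auto
  with less show "\<forall>\<^sub>F n in sequentially. dist ((h (b n) - h (a n)) / (b n - a n)) (h' q) < \<epsilon>"
  proof eventually_elim
    case (elim n)
    have in_ball: "dist x q < r" if "a n \<le> x" "x \<le> b n" for x
      using elim that by (auto simp: dist_real_def)
    have "(h has_real_derivative h' x) (at x)" if "a n \<le> x" "x \<le> b n" for x
      using in_ball[OF that] by (intro der) (simp add: r_def dist_commute)
    then obtain z where z: "a n < z" "z < b n" "h (b n) - h (a n) = (b n - a n) * h' z"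
      using MVT2[of "a n" "b n" h h'] elim(1) by auto
    then have "(h (b n) - h (a n)) / (b n - a n) = h' z" by simp
    moreover have "dist (h' z) (h' q) < \<epsilon>"
      using in_ball[of z] z by (intro r0) (simp add: r_def)
    ultimately show ?case by simp
  qed
qed

text \<open>\<open>\<Phi>\<close> is the lift of a symmetric homeomorphism, \<open>E\<close> a parametrization of an interval by the whole
  line whose inverse is \<open>\<tau>\<close>, and \<open>\<Phi> \<circ> E\<close> conjugates multiplication by \<open>A\<close> to \<open>G\<close>.  The coordinate
  change \<open>E\<close> has to be carried along because symmetry is a statement about equal lengths in the
  angle coordinate, whereas the dynamics is linear in the coordinate of the line.\<close>
locale symmetric_conjugacy =
  fixes \<alpha> A e :: real and \<Phi> G E \<tau> :: "real \<Rightarrow> real"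
  assumes alpha_pos: "\<alpha> > 0"
    and Phi_cont: "continuous_on UNIV \<Phi>" and Phi_mono: "strict_mono \<Phi>"
    and Phi_symmetric: "uniform_limit UNIV (\<lambda>t x. qs_ratio \<Phi> x t) (\<lambda>_. 1) (at_right 0)"
    and G_diffeo: "holder_diffeo_on \<alpha> UNIV G"
    and A_pos: "0 < A" and A_less_1: "A < 1"
    and E_cont: "continuous_on UNIV E" and E_mono: "strict_mono E"
    and E_deriv: "(E has_real_derivative e) (at 0)" and e_pos: "e > 0"
    and \<tau>_deriv: "(\<tau> has_real_derivative inverse e) (at (E 0))"
    and \<tau>_E: "\<And>v. \<tau> (E v) = v" and E_\<tau>: "\<forall>\<^sub>F y in nhds (E 0). E (\<tau> y) = y"
    and conj: "\<And>v. G (\<Phi> (E v)) = \<Phi> (E (A * v))"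
begin

abbreviation "F v \<equiv> \<Phi> (E v)"

lemma qs_ratio_tendsto:
  assumes "filterlim s (at_right 0) L"
  shows "((\<lambda>n. qs_ratio \<Phi> (x n) (s n)) \<longlongrightarrow> 1) L"
proof (rule tendstoI)
  fix \<epsilon> :: real assume "\<epsilon> > 0"
  from uniform_limitD[OF Phi_symmetric this]
  have "\<forall>\<^sub>F t in at_right 0. \<forall>x. dist (qs_ratio \<Phi> x t) 1 < \<epsilon>" by simp
  then have "\<forall>\<^sub>F n in L. \<forall>x. dist (qs_ratio \<Phi> x (s n)) 1 < \<epsilon>"
    using assms by (auto simp: filterlim_iff)
  then show "\<forall>\<^sub>F n in L. dist (qs_ratio \<Phi> (x n) (s n)) 1 < \<epsilon>"
    by (rule eventually_mono) simp
qed

lemma F_cont: "continuous_on UNIV F"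
  using continuous_on_compose2[OF Phi_cont E_cont] by simp

lemma isCont_F: "isCont F v"
  using F_cont by (simp add: continuous_on_eq_continuous_at)

lemma F_mono: "strict_mono F"
  using Phi_mono E_mono by (simp add: strict_mono_def)

lemma inj_F: "inj F"
  using F_mono by (rule strict_mono_imp_inj_on)

lemma iterate_conj: "(G ^^ n) (F v) = F (A ^ n * v)"
  by (induction n) (simp_all add: conj mult.assoc)

lemma G_fixed: "G (F 0) = F 0"
  using conj[of 0] by simp

text \<open>Symmetry bounds \<open>\<Phi> (E 0 + s) - \<Phi> (E 0)\<close> by two thirds of \<open>\<Phi> (E 0 + 2 s) - \<Phi> (E 0)\<close> for small \<open>s\<close>.
  A power \<open>A\<^sup>m < 1/2\<close> more than halves small distances to \<open>E 0\<close>, hence the \<open>m\<close>-th iterate of \<open>G\<close>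
  multiplies small distances to its fixed point by at most \<open>2/3\<close>, and so \<open>\<mu>\<^sup>m \<le> 2/3\<close>.\<close>
lemma multiplier_less_1:
  assumes D: "(G has_real_derivative \<mu>) (at (F 0))"
  shows "\<mu> < 1"
proof -
  obtain m where m: "A ^ m < 1 / 2"
    using real_arch_pow_inv[of "1/2" A] A_less_1 by auto
  have "((G ^^ n) has_real_derivative \<mu> ^ n) (at (F 0))" for n
  proof (induction n)
    case (Suc n)
    have "(G ^^ n) (F 0) = F 0" using iterate_conj[of n 0] by simp
    then show ?case using DERIV_chain2[of G \<mu> "G ^^ n" "F 0" "\<mu> ^ n" UNIV] D Suc by (simp add: comp_def)
  qed (simp add: id_def)
  then have "((G ^^ m) has_real_derivative \<mu> ^ m) (at (F 0))" .
  then have "((\<lambda>y. ((G ^^ m) y - (G ^^ m) (F 0)) / (y - F 0)) \<longlongrightarrow> \<mu> ^ m) (at (F 0))"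
    by (simp add: has_field_derivative_iff)
  moreover have "filterlim F (at (F 0)) (at_right 0)"
    unfolding filterlim_at
  proof
    show "(F \<longlongrightarrow> F 0) (at_right 0)"
      using isCont_F[of 0] by (simp add: isCont_def filterlim_at_split)
    show "\<forall>\<^sub>F x in at_right 0. F x \<in> UNIV \<and> F x \<noteq> F 0"
      using eventually_at_right_less[of 0] by (rule eventually_mono) (use strict_monoD[OF F_mono, of 0] in force)
  qed
  ultimately have lim: "((\<lambda>v. ((G ^^ m) (F v) - (G ^^ m) (F 0)) / (F v - F 0)) \<longlongrightarrow> \<mu> ^ m) (at_right 0)"
    by (rule filterlim_compose)
  \<comment> \<open>Symmetry is applied at the midpoint \<open>E 0 + s v\<close> of the interval from \<open>E 0\<close> to \<open>E v\<close>.\<close>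
  define s where "s v = (E v - E 0) / 2" for v
  have s_0: "s 0 = 0" by (simp add: s_def)
  have s_pos: "\<forall>\<^sub>F v in at_right 0. s v > 0"
    using eventually_at_right_less[of 0] E_mono by (auto elim!: eventually_mono simp: s_def strict_mono_def)
  have "(s \<longlongrightarrow> (E 0 - E 0) / 2) (at_right 0)"
    unfolding s_def using E_cont by (intro tendsto_intros)
      (auto simp: continuous_on_eq_continuous_at isCont_def filterlim_at_split)
  then have s_lim: "filterlim s (at_right 0) (at_right 0)"
    unfolding filterlim_at using s_pos by (auto elim: eventually_mono)
  have "\<forall>\<^sub>F v in at_right 0. qs_ratio \<Phi> (E 0 + s v) (s v) > 1 / 2"
    using order_tendstoD(1)[OF qs_ratio_tendsto[OF s_lim], of "1/2"] by simp
  moreover have "\<forall>\<^sub>F v in at_right 0. E (A ^ m * v) - E 0 \<le> s v"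
  proof -
    have "((\<lambda>v. E (A ^ m * v) - s v) has_real_derivative e * A ^ m - e / 2) (at 0)"
    proof -
      have "((\<lambda>v. E (A ^ m * v)) has_real_derivative e * A ^ m) (at 0)"
        by (rule DERIV_chain2[where f = E]) (use E_deriv in \<open>auto intro!: derivative_eq_intros\<close>)
      moreover have "(s has_real_derivative (e - 0) / 2) (at 0)"
        unfolding s_def by (intro DERIV_cdivide DERIV_diff E_deriv DERIV_const)
      ultimately show ?thesis using DERIV_diff by fastforce
    qed
    moreover have "e * A ^ m - e / 2 < 0"
      using m e_pos mult_strict_left_mono[of "A ^ m" "1/2" e] by simp
    ultimately obtain d where d: "d > 0"
      "\<And>v. v > 0 \<Longrightarrow> v < d \<Longrightarrow> E (A ^ m * v) - s v < E (A ^ m * 0) - s 0"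
      using DERIV_neg_dec_right[of "\<lambda>v. E (A ^ m * v) - s v" "e * A ^ m - e / 2" 0] by auto
    then show ?thesis
      unfolding eventually_at_right_field
    proof (intro exI[of _ d] conjI allI impI)
      fix v assume "0 < v" "v < d"
      then show "E (A ^ m * v) - E 0 \<le> s v" using d(2)[of v] s_0 by simp
    qed
  qed
  ultimately have "\<forall>\<^sub>F v in at_right 0. ((G ^^ m) (F v) - (G ^^ m) (F 0)) / (F v - F 0) \<le> 2 / 3"
    using s_pos
  proof eventually_elim
    case (elim v)
    have Ev: "E 0 + s v + s v = E v" by (simp add: s_def field_simps)
    have pos: "F 0 < \<Phi> (E 0 + s v)" "\<Phi> (E 0 + s v) < F v"
      using Phi_mono elim Ev by (auto simp: strict_mono_def)
    have "1 / 2 < (F v - \<Phi> (E 0 + s v)) / (\<Phi> (E 0 + s v) - F 0)"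
      using elim(1) by (simp add: qs_ratio_def Ev)
    then have "\<Phi> (E 0 + s v) - F 0 \<le> 2 / 3 * (F v - F 0)"
      using pos by (simp add: field_simps)
    moreover have "F (A ^ m * v) \<le> \<Phi> (E 0 + s v)"
      using Phi_mono elim(2) by (simp add: strict_mono_less_eq)
    ultimately have "F (A ^ m * v) - F 0 \<le> 2 / 3 * (F v - F 0)" by simp
    then show ?case using pos iterate_conj[of m v] iterate_conj[of m 0] by (simp add: divide_simps)
  qed
  then have "\<mu> ^ m \<le> 2 / 3"
    by (rule tendsto_upperbound[OF lim]) simp
  show "\<mu> < 1"
  proof (rule ccontr)
    assume "\<not> \<mu> < 1"
    then have "1 \<le> \<mu> ^ m" by simp
    with \<open>\<mu> ^ m \<le> 2 / 3\<close> show False by simp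
  qed
qed

text \<open>The ratio of the two increments of \<open>h \<circ> F\<close> is invariant under scaling by \<open>A\<close>, so it can be
  computed at arbitrarily small scales, where symmetry of \<open>\<Phi>\<close> and strict differentiability of \<open>h\<close>
  at \<open>F 0\<close> make it \<open>1\<close>.\<close>
lemma linearized_midpoint:
  assumes "holder_diffeo_on \<alpha> (ball (F 0) \<delta>) h" "\<delta> > 0" "\<mu> > 0"
    and h: "\<And>x. x \<in> ball (F 0) \<delta> \<Longrightarrow> h (G x) = \<mu> * h x"
    and \<epsilon>: "\<And>v. \<bar>v\<bar> < \<epsilon> \<Longrightarrow> F v \<in> ball (F 0) \<delta>" "\<epsilon> > 0"
    and v: "\<bar>v\<bar> < \<epsilon>" "\<bar>v + t\<bar> < \<epsilon>" "\<bar>v - t\<bar> < \<epsilon>" "t > 0"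
  shows "h (F (v + t)) - h (F v) = h (F v) - h (F (v - t))"
proof -
  obtain h' where h': "\<And>x. x \<in> ball (F 0) \<delta> \<Longrightarrow> (h has_real_derivative h' x) (at x)"
     "\<And>x. x \<in> ball (F 0) \<delta> \<Longrightarrow> h' x > 0" "holder_on \<alpha> (ball (F 0) \<delta>) h'"
    using assms(1) by (rule holder_diffeo_onE) blast
  have h'0: "h' (F 0) > 0" using h'(2) \<open>\<delta> > 0\<close> by simp
  have cont_h': "isCont h' (F 0)"
    using holder_on_imp_continuous_on[OF h'(3) alpha_pos] \<open>\<delta> > 0\<close>
    by (simp add: continuous_on_eq_continuous_at)
  define a where "a n = A ^ n" for n
  have a_pos: "a n > 0" for n using A_pos by (simp add: a_def)
  have a_lim: "a \<longlonglongrightarrow> 0" unfolding a_def using A_pos A_less_1 by (intro LIMSEQ_power_zero) simp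
  have a_lim_at: "filterlim a (at 0) sequentially"
    unfolding filterlim_at using a_lim a_pos by (auto simp: less_imp_neq[symmetric])
  have a_le_1: "a n \<le> 1" for n unfolding a_def using A_pos A_less_1 by (simp add: power_le_one)
  have small: "\<bar>a n * w\<bar> < \<epsilon>" if "\<bar>w\<bar> < \<epsilon>" for n w
  proof -
    have "\<bar>a n * w\<bar> \<le> 1 * \<bar>w\<bar>"
      unfolding abs_mult using a_pos[of n] a_le_1[of n] by (intro mult_right_mono) auto
    then show ?thesis using that by simp
  qed
  have scale: "h (F (a n * w)) = \<mu> ^ n * h (F w)" if "\<bar>w\<bar> < \<epsilon>" for n w
  proof (induction n)
    case (Suc n)
    have "F (a (Suc n) * w) = G (F (a n * w))" by (simp add: conj a_def mult.assoc)
    then show ?case using h[OF \<epsilon>(1)[OF small[OF that]]] Suc by simp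
  qed (simp add: a_def)

  \<comment> \<open>Symmetry compares exactly equal lengths in the angle, but \<open>E\<close> does not send the midpoint of
    \<open>a n * (v - t)\<close> and \<open>a n * (v + t)\<close> to a midpoint.  So the right-hand
    length \<open>s n\<close> is laid off to the left of \<open>x n\<close>, and the point reached is pulled back and rescaled to \<open>u n\<close>.
    Since \<open>E\<close> is differentiable at \<open>0\<close>, \<open>u n\<close> converges to \<open>v - t\<close>, and continuity of \<open>h \<circ> F\<close> does the rest.\<close>
  define x where "x n = E (a n * v)" for n
  define s where "s n = E (a n * (v + t)) - x n" for n
  define u where "u n = \<tau> (x n - s n) / a n" for n
  have E_lim: "(\<lambda>n. E (a n * w)) \<longlonglongrightarrow> E 0" for w
  proof -
    have "(\<lambda>n. a n * w) \<longlonglongrightarrow> 0 * w" by (intro tendsto_intros a_lim)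
    then show ?thesis
      using E_cont isCont_tendsto_compose[of 0 E] by (simp add: continuous_on_eq_continuous_at)
  qed
  have x_lim: "x \<longlonglongrightarrow> E 0" unfolding x_def by (rule E_lim)
  have s_lim0: "s \<longlonglongrightarrow> 0"
    unfolding s_def x_def using tendsto_diff[OF E_lim E_lim, of "v + t" v] by simp
  have s_pos: "s n > 0" for n
    unfolding s_def x_def using E_mono a_pos[of n] v(4) by (simp add: strict_mono_less)
  have s_lim: "filterlim s (at_right 0) sequentially"
    unfolding filterlim_at using s_lim0 by (simp add: s_pos less_imp_neq[OF s_pos, symmetric])
  have y_lim: "(\<lambda>n. x n - s n) \<longlonglongrightarrow> E 0"
    using tendsto_diff[OF x_lim s_lim0] by simp
  have "((\<lambda>\<epsilon>. \<tau> (2 * E (\<epsilon> * v) - E (\<epsilon> * (v + t)))) has_real_derivative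
      inverse e * (2 * (e * v) - e * (v + t))) (at 0)"
  proof (rule DERIV_chain2[where f = \<tau>])
    show "(\<tau> has_real_derivative inverse e) (at (2 * E (0 * v) - E (0 * (v + t))))"
      using \<tau>_deriv by simp
    have "((\<lambda>\<epsilon>. E (\<epsilon> * w)) has_real_derivative e * w) (at 0)" for w
      by (rule DERIV_chain2[where f = E]) (use E_deriv in \<open>auto intro!: derivative_eq_intros\<close>)
    then show "((\<lambda>\<epsilon>. 2 * E (\<epsilon> * v) - E (\<epsilon> * (v + t))) has_real_derivative 2 * (e * v) - e * (v + t)) (at 0)"
      by (intro DERIV_diff DERIV_cmult)
  qed
  moreover have "inverse e * (2 * (e * v) - e * (v + t)) = v - t"
    using e_pos by (simp add: field_simps)
  moreover have "\<tau> (2 * E 0 - E 0) = 0" using \<tau>_E[of 0] by simp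
  ultimately have "((\<lambda>\<epsilon>. \<tau> (2 * E (\<epsilon> * v) - E (\<epsilon> * (v + t))) / \<epsilon>) \<longlongrightarrow> v - t) (at 0)"
    by (simp add: has_field_derivative_iff)
  from filterlim_compose[OF this a_lim_at] have u_lim: "u \<longlonglongrightarrow> v - t"
    unfolding u_def x_def s_def by simp
  have E_u: "\<forall>\<^sub>F n in sequentially. E (a n * u n) = x n - s n"
  proof -
    have "\<forall>\<^sub>F n in sequentially. E (\<tau> (x n - s n)) = x n - s n"
      using y_lim E_\<tau> by (auto simp: filterlim_iff)
    then show ?thesis by (rule eventually_mono) (use a_pos in \<open>simp add: u_def less_imp_neq[symmetric]\<close>)
  qed
  have u_small: "\<forall>\<^sub>F n in sequentially. \<bar>u n\<bar> < \<epsilon>"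
    using order_tendstoD(2)[OF tendsto_rabs[OF u_lim] v(3)] .

  have isCont_Phi: "isCont \<Phi> y" for y using Phi_cont by (simp add: continuous_on_eq_continuous_at)
  have lims: "(\<lambda>n. \<Phi> (x n + s n)) \<longlonglongrightarrow> F 0" "(\<lambda>n. \<Phi> (x n)) \<longlonglongrightarrow> F 0" "(\<lambda>n. \<Phi> (x n - s n)) \<longlonglongrightarrow> F 0"
    using isCont_tendsto_compose[OF isCont_Phi, OF tendsto_add[OF x_lim s_lim0]]
      isCont_tendsto_compose[OF isCont_Phi, OF x_lim] isCont_tendsto_compose[OF isCont_Phi, OF y_lim] by simp_all
  have Phi_less: "\<Phi> (x n - s n) < \<Phi> (x n)" "\<Phi> (x n) < \<Phi> (x n + s n)" for n
    using s_pos[of n] Phi_mono by (auto simp: strict_mono_less)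
  define Q1 where "Q1 n = (h (\<Phi> (x n + s n)) - h (\<Phi> (x n))) / (\<Phi> (x n + s n) - \<Phi> (x n))" for n
  define Q2 where "Q2 n = (h (\<Phi> (x n)) - h (\<Phi> (x n - s n))) / (\<Phi> (x n) - \<Phi> (x n - s n))" for n
  have Q1: "Q1 \<longlonglongrightarrow> h' (F 0)" unfolding Q1_def
    by (rule difference_quotients_tendsto[OF h'(1) \<open>\<delta> > 0\<close> cont_h' lims(2,1)]) (use Phi_less in auto)
  have Q2: "Q2 \<longlonglongrightarrow> h' (F 0)" unfolding Q2_def
    by (rule difference_quotients_tendsto[OF h'(1) \<open>\<delta> > 0\<close> cont_h' lims(3,2)]) (use Phi_less in auto)
  have "(\<lambda>n. Q1 n / Q2 n * qs_ratio \<Phi> (x n) (s n)) \<longlonglongrightarrow> h' (F 0) / h' (F 0) * 1"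
    using h'0 by (intro tendsto_intros Q1 Q2 qs_ratio_tendsto s_lim) auto
  moreover have "(\<lambda>n. h (F (u n))) \<longlonglongrightarrow> h (F (v - t))"
    by (intro isCont_tendsto_compose[OF _ isCont_tendsto_compose[OF isCont_F u_lim]]
        DERIV_isCont[OF h'(1)] \<epsilon> v)
  ultimately have "(\<lambda>n. Q1 n / Q2 n * qs_ratio \<Phi> (x n) (s n) * (h (F v) - h (F (u n)))) \<longlonglongrightarrow>
      1 * (h (F v) - h (F (v - t)))"
    using h'0 by (intro tendsto_intros) auto
  moreover have "\<forall>\<^sub>F n in sequentially. Q1 n / Q2 n * qs_ratio \<Phi> (x n) (s n) * (h (F v) - h (F (u n)))
      = h (F (v + t)) - h (F v)"
    using E_u u_small order_tendstoD(1)[OF Q2 h'0]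
  proof eventually_elim
    case (elim n)
    have 1: "h (\<Phi> (x n + s n)) - h (\<Phi> (x n)) = \<mu> ^ n * (h (F (v + t)) - h (F v))"
      using scale[OF v(1), of n] scale[OF v(2), of n] by (simp add: x_def s_def algebra_simps)
    have 2: "h (\<Phi> (x n)) - h (\<Phi> (x n - s n)) = \<mu> ^ n * (h (F v) - h (F (u n)))"
      using scale[OF v(1), of n] scale[OF elim(2), of n] by (simp add: x_def elim(1)[unfolded x_def] right_diff_distrib)
    have top: "Q1 n * qs_ratio \<Phi> (x n) (s n) * (\<Phi> (x n) - \<Phi> (x n - s n)) = \<mu> ^ n * (h (F (v + t)) - h (F v))"
      using Phi_less[of n] 1 by (simp add: Q1_def qs_ratio_def)
    have bottom: "Q2 n * (\<Phi> (x n) - \<Phi> (x n - s n)) = \<mu> ^ n * (h (F v) - h (F (u n)))"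
      using Phi_less[of n] 2 by (simp add: Q2_def)
    have "Q1 n * qs_ratio \<Phi> (x n) (s n) * (\<mu> ^ n * (h (F v) - h (F (u n))))
        = Q2 n * (\<mu> ^ n * (h (F (v + t)) - h (F v)))"
      by (simp only: top[symmetric] bottom[symmetric] mult_ac)
    then have "\<mu> ^ n * (Q1 n * qs_ratio \<Phi> (x n) (s n) * (h (F v) - h (F (u n))))
        = \<mu> ^ n * (Q2 n * (h (F (v + t)) - h (F v)))"
      by (simp add: mult_ac)
    then have "Q1 n * qs_ratio \<Phi> (x n) (s n) * (h (F v) - h (F (u n))) = Q2 n * (h (F (v + t)) - h (F v))"
      using \<open>\<mu> > 0\<close> by simp
    then show ?case using elim(3) by (simp add: field_simps)
  qed
  ultimately have "(\<lambda>n. h (F (v + t)) - h (F v)) \<longlonglongrightarrow> 1 * (h (F v) - h (F (v - t)))"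
    by (rule Lim_transform_eventually)
  then show ?thesis by (simp add: LIMSEQ_const_iff)
qed

text \<open>Near \<open>0\<close> the map \<open>h \<circ> F\<close> is continuous and midpoint affine, hence affine with positive slope;
  cancelling \<open>h\<close> on the left gives the regularity of \<open>F\<close>.\<close>
lemma holder_diffeo_near_fixed_point:
  obtains d where "d > 0" "holder_diffeo_on \<alpha> {-d..d} F"
proof -
  obtain G' where G': "\<And>x. (G has_real_derivative G' x) (at x)" "\<And>x. G' x > 0"
    by (rule holder_diffeo_onE[OF G_diffeo]) blast
  define \<mu> where "\<mu> = G' (F 0)"
  have \<mu>: "(G has_real_derivative \<mu>) (at (F 0))" "\<mu> > 0" using G' by (auto simp: \<mu>_def)
  obtain \<delta> h where h: "\<delta> > 0" "holder_diffeo_on \<alpha> (ball (F 0) \<delta>) h" 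
    "\<And>x. x \<in> ball (F 0) \<delta> \<Longrightarrow> h (G x) = \<mu> * h x"
    using Sternberg_linearization[OF G_diffeo G_fixed \<mu>(1) multiplier_less_1[OF \<mu>(1)] alpha_pos] by metis
  have "\<forall>\<^sub>F v in nhds 0. F v \<in> ball (F 0) \<delta>"
    using isCont_F[of 0] h(1) topological_tendstoD[of F "F 0" "at 0" "ball (F 0) \<delta>"]
    by (simp add: eventually_nhds_conv_at isCont_def)
  then obtain \<epsilon> where \<epsilon>: "\<epsilon> > 0" "\<And>v. \<bar>v\<bar> < \<epsilon> \<Longrightarrow> F v \<in> ball (F 0) \<delta>"
    unfolding eventually_nhds_metric dist_real_def by auto
  obtain h' where h': "\<And>x. x \<in> ball (F 0) \<delta> \<Longrightarrow> (h has_real_derivative h' x) (at x)"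
     "\<And>x. x \<in> ball (F 0) \<delta> \<Longrightarrow> h' x > 0"
    using h(2) by (rule holder_diffeo_onE) blast
  define b where "b = \<epsilon> / 2"
  have b: "b > 0" "b < \<epsilon>" using \<epsilon>(1) by (auto simp: b_def)
  define k where "k = (h (F b) - h (F (- b))) / (b - (- b))"
  have affine: "h (F v) = h (F (- b)) + k * (v - (- b))" if "v \<in> {- b..b}" for v
    unfolding k_def
  proof (rule midpoint_affine_continuous_imp_affine[where H = "\<lambda>v. h (F v)"])
    show "continuous_on {- b..b} (\<lambda>v. h (F v))"
    proof (intro continuous_at_imp_continuous_on ballI)
      fix v assume "v \<in> {- b..b}"
      then have "F v \<in> ball (F 0) \<delta>" using b by (intro \<epsilon>) auto
      then show "isCont (\<lambda>v. h (F v)) v"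
        by (intro isCont_o2[OF isCont_F] DERIV_isCont[OF h'(1)])
    qed
    show "h (F (x + t)) - h (F x) = h (F x) - h (F (x - t))" if "0 < t" "- b \<le> x - t" "x + t \<le> b" for x t
      using that b by (intro linearized_midpoint[OF h(2,1) \<mu>(2) h(3) \<epsilon>(2,1)]) auto
  qed (use b that in auto)
  have "F (- b) < F b" using strict_monoD[OF F_mono, of "- b" b] b by simp
  moreover have "x \<in> ball (F 0) \<delta>" if "F (- b) \<le> x" "x \<le> F b" for x
    using \<epsilon>(2)[of b] \<epsilon>(2)[of "- b"] b that by (auto simp: dist_real_def)
  ultimately have "h (F (- b)) < h (F b)"
    using DERIV_pos_imp_increasing[of "F (- b)" "F b" h] h' by blast
  then have "k > 0" using b by (simp add: k_def)
  have "holder_diffeo_on \<alpha> {- (b/2)..b/2} F"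
  proof (rule holder_diffeo_on_cancel_left[OF _ h(2) _ F_cont inj_F alpha_pos])
    show "holder_diffeo_on \<alpha> {- (b/2)..b/2} (\<lambda>v. h (F (- b)) + k * (v - (- b)))"
      unfolding holder_diffeo_on_def using \<open>k > 0\<close>
      by (intro exI[of _ "\<lambda>_. k"]) (auto intro!: derivative_eq_intros holder_on_const)
    show "F ` {- (b/2)..b/2} \<subseteq> ball (F 0) \<delta>" using \<epsilon>(2) b by force
    show "open {- b<..<b}" "{- (b/2)..b/2} \<subseteq> {- b<..<b}" using b by auto
    show "h (F v) = h (F (- b)) + k * (v - (- b))" if "v \<in> {- b<..<b}" for v
      using that by (intro affine) auto
  qed
  then show ?thesis using that[of "b/2"] b by simp
qed

text \<open>In \<open>G \<circ> F = F \<circ> A\<close> the right-hand side is regular on an interval that is larger by the factor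
  \<open>1/A\<close>, and cancelling the diffeomorphism \<open>G\<close> transfers this to \<open>F\<close>.\<close>
lemma holder_diffeo_on_basin: "holder_diffeo_on \<alpha> {-R..R} F"
proof -
  obtain d where d: "d > 0" "holder_diffeo_on \<alpha> {-d..d} F"
    by (rule holder_diffeo_near_fixed_point)
  have step: "holder_diffeo_on \<alpha> {-(d / A ^ n)..d / A ^ n} F" for n
  proof (induction n)
    case (Suc n)
    show ?case
    proof (rule holder_diffeo_on_cancel_left[where U = UNIV, OF _ G_diffeo _ F_cont inj_F alpha_pos])
      show "holder_diffeo_on \<alpha> {-(d / A ^ Suc n)..d / A ^ Suc n} (\<lambda>v. F (A * v))"
      proof (rule holder_diffeo_on_compose[OF _ Suc _ alpha_pos])
        show "holder_diffeo_on \<alpha> {-(d / A ^ Suc n)..d / A ^ Suc n} ((*) A)"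
          unfolding holder_diffeo_on_def using A_pos
          by (intro exI[of _ "\<lambda>_. A"]) (auto intro!: derivative_eq_intros holder_on_const)
        show "(*) A ` {-(d / A ^ Suc n)..d / A ^ Suc n} \<subseteq> {-(d / A ^ n)..d / A ^ n}"
          using A_pos by (auto simp: field_simps)
      qed
      show "G (F v) = F (A * v)" for v by (rule conj)
    qed auto
  qed (use d in simp)
  obtain n where "A ^ n < d / (\<bar>R\<bar> + 1)"
    using real_arch_pow_inv[of "d / (\<bar>R\<bar> + 1)" A] A_less_1 d(1) by auto
  then have "\<bar>R\<bar> \<le> d / A ^ n" using zero_less_power[OF A_pos, of n] by (simp add: field_simps)
  then show ?thesis by (intro holder_diffeo_on_subset[OF step[of n]]) auto
qed

end

section \<open>Circle maps and their lifts\<close>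

lemma cis_eq_1_iff: "cis x = 1 \<longleftrightarrow> (\<exists>n::int. x = of_int n * 2 * pi)"
proof
  assume "cis x = 1"
  then have "cos x = 1" by (simp add: complex_eq_iff)
  then show "\<exists>n::int. x = of_int n * 2 * pi" by (simp add: cos_one_2pi_int)
next
  assume "\<exists>n::int. x = of_int n * 2 * pi"
  then obtain n :: int where "x = 2 * pi * of_int n" by (auto simp: mult_ac)
  then show "cis x = 1" by (simp add: cis_multiple_2pi)
qed

text \<open>Uniqueness of lifts: the difference is continuous with values in the discrete set \<open>2 \<pi> \<int>\<close>.\<close>
lemma cis_eq_cis_imp_differ_by_constant:
  assumes "continuous_on UNIV G" "continuous_on UNIV H" "\<And>x::real. cis (G x) = cis (H x)"
  obtains c where "cis c = 1" "\<And>x. G x = H x + c"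
proof -
  have one: "cis (G x - H x) = 1" for x
    using assms(3)[of x] by (simp flip: cis_divide)
  have "(\<lambda>x. G x - H x) constant_on UNIV"
  proof (rule continuous_discrete_range_constant)
    fix x :: real
    have "2 * pi \<le> norm ((G y - H y) - (G x - H x))" if "G y - H y \<noteq> G x - H x" for y
    proof -
      obtain m n :: int where mn: "G y - H y = of_int m * 2 * pi" "G x - H x = of_int n * 2 * pi"
        using one[of x] one[of y] unfolding cis_eq_1_iff by blast
      then have "m \<noteq> n" using that by auto
      then have "1 \<le> \<bar>real_of_int (m - n)\<bar>" by linarith
      moreover have "(G y - H y) - (G x - H x) = of_int (m - n) * (2 * pi)"
        using mn by (simp add: algebra_simps)
      ultimately show ?thesis by (simp add: abs_mult)
    qed
    then show "\<exists>e>0. \<forall>y. y \<in> UNIV \<and> G y - H y \<noteq> G x - H x \<longrightarrow> e \<le> norm (G y - H y - (G x - H x))"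
      by (intro exI[of _ "2 * pi"]) auto
  qed (use assms in \<open>auto intro!: continuous_intros\<close>)
  then obtain c where c: "\<And>x. G x - H x = c" unfolding constant_on_def by blast
  then show ?thesis using that[of c] one[of 0] by (metis add.commute diff_add_cancel)
qed

lemma cis_in_unit_circle [simp]: "cis x \<in> unit_circle"
  by simp

lemma unit_circle_cisE:
  assumes "z \<in> unit_circle" obtains x where "z = cis x" "- pi < x" "x \<le> pi"
proof -
  have "z = cis (Arg z)" using assms cis_Arg[of z] by (cases "z = 0") (auto simp: sgn_div_norm)
  then show ?thesis using that Arg_bounded[of z] by blast
qed

lemma circle_lift_unique:
  assumes "circle_lift g G" "circle_lift g H"
  obtains c where "cis c = 1" "\<And>x. G x = H x + c"
proof -
  have "continuous_on UNIV G" "continuous_on UNIV H" "cis (G x) = cis (H x)" for x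
    using assms unfolding circle_lift_def by (blast, blast, metis)
  then show ?thesis using cis_eq_cis_imp_differ_by_constant[of G H] that by blast
qed

lemma circle_homeo_plus_in_carrier:
  assumes "f \<in> circle_homeo_plus" shows "f \<in> carrier circle_bij"
proof -
  obtain h where "homeomorphism unit_circle unit_circle f h"
    using assms by (auto simp: circle_homeo_plus_def)
  then have "bij_betw f unit_circle unit_circle"
    unfolding homeomorphism_def by (intro bij_betw_byWitness[where f' = h]) auto
  then show ?thesis
    using assms by (simp add: BijGroup_def Bij_def circle_homeo_plus_def)
qed

lemma circle_bij_mult_apply:
  assumes "g \<in> carrier circle_bij" "h \<in> carrier circle_bij" "z \<in> unit_circle"
  shows "(g \<otimes>\<^bsub>circle_bij\<^esub> h) z = g (h z)"
  using assms by (simp add: BijGroup_def compose_def)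

lemma circle_bij_apply_inv:
  assumes "f \<in> carrier circle_bij" "z \<in> unit_circle"
  shows "(inv\<^bsub>circle_bij\<^esub> f) (f z) = z" "f ((inv\<^bsub>circle_bij\<^esub> f) z) = z"
    "(inv\<^bsub>circle_bij\<^esub> f) z \<in> unit_circle" "f z \<in> unit_circle"
proof -
  have f: "bij_betw f unit_circle unit_circle" "f \<in> Bij unit_circle"
    using assms(1) by (auto simp: BijGroup_def Bij_def)
  then show fz: "f z \<in> unit_circle" using bij_betw_apply[OF f(1) assms(2)] by simp
  have "inv\<^bsub>circle_bij\<^esub> f = (\<lambda>x\<in>unit_circle. inv_into unit_circle f x)"
    using f(2) by (rule inv_BijGroup)
  then show "(inv\<^bsub>circle_bij\<^esub> f) (f z) = z" "f ((inv\<^bsub>circle_bij\<^esub> f) z) = z"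
    "(inv\<^bsub>circle_bij\<^esub> f) z \<in> unit_circle"
    using f(1) fz assms(2) bij_betw_inv_into_left[OF f(1)] bij_betw_inv_into_right[OF f(1)]
      bij_betw_apply[OF bij_betw_inv_into[OF f(1)]] by auto
qed

lemma circle_lift_period:
  assumes "circle_lift f \<Phi>" "strict_mono \<Phi>"
  obtains c where "c > 0" "\<And>x. \<Phi> (x + 2 * pi) = \<Phi> x + c"
proof -
  have cont: "continuous_on UNIV \<Phi>" using assms by (simp add: circle_lift_def)
  have "cis (\<Phi> (x + 2 * pi)) = cis (\<Phi> x)" for x
  proof -
    have "cis (\<Phi> (x + 2 * pi)) = f (cis (x + 2 * pi))" using assms(1) by (simp add: circle_lift_def)
    also have "cis (x + 2 * pi) = cis x" by (simp flip: cis_mult)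
    finally show ?thesis using assms(1) by (simp add: circle_lift_def)
  qed
  moreover have "continuous_on UNIV (\<lambda>x. \<Phi> (x + 2 * pi))"
    by (rule continuous_on_compose2[OF cont]) (auto intro: continuous_intros)
  ultimately obtain c where c: "\<And>x. \<Phi> (x + 2 * pi) = \<Phi> x + c"
    using cis_eq_cis_imp_differ_by_constant[of "\<lambda>x. \<Phi> (x + 2 * pi)" \<Phi>] cont by blast
  moreover have "c > 0"
    using c[of 0] strict_monoD[OF assms(2), of 0 "2 * pi"] by simp
  ultimately show ?thesis using that by blast
qed

text \<open>A strictly increasing lift gains a positive constant over each period, so it is unbounded in both
  directions and the intermediate value theorem applies.\<close>
lemma circle_lift_bij:
  assumes "circle_lift f \<Phi>" "strict_mono \<Phi>"
  shows "bij \<Phi>"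
proof -
  obtain c where c: "c > 0" "\<And>x. \<Phi> (x + 2 * pi) = \<Phi> x + c"
    using circle_lift_period[OF assms] by blast
  have "\<exists>x. y = \<Phi> x" for y
  proof (rule shift_induct_real[OF c(1), where a = "\<Phi> 0" and P = "\<lambda>y. \<exists>x. y = \<Phi> x"])
    fix y assume "y \<in> {\<Phi> 0..\<Phi> 0 + c}"
    then show "\<exists>x. y = \<Phi> x"
      using IVT'[of \<Phi> 0 y "2 * pi"] c(2)[of 0] assms(1) continuous_on_subset[of UNIV \<Phi>]
      by (auto simp: circle_lift_def)
  next
    fix y assume "\<exists>x. y = \<Phi> x"
    then obtain x where x: "y = \<Phi> x" by blast
    show "\<exists>x. y + c = \<Phi> x" using c(2)[of x] x by metis
    show "\<exists>x. y - c = \<Phi> x" using c(2)[of "x - 2 * pi"] x by (intro exI[of _ "x - 2 * pi"]) simp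
  qed
  then show ?thesis using strict_mono_imp_inj_on[OF assms(2)] by (auto simp: bij_def surj_def)
qed

text \<open>The lifts in the definition of symmetry and in that of an orientation preserving homeomorphism
  may differ, but only by a constant, so that one lift serves both purposes.\<close>
lemma Sym_circle_lift:
  assumes "f \<in> Sym_circle"
  obtains \<Phi> where "circle_lift f \<Phi>" "strict_mono \<Phi>"
    "uniform_limit UNIV (\<lambda>t x. qs_ratio \<Phi> x t) (\<lambda>_. 1) (at_right 0)"
proof -
  obtain G where G: "circle_lift f G" "uniform_limit UNIV (\<lambda>t x. qs_ratio G x t) (\<lambda>_. 1) (at_right 0)"
    using assms by (auto simp: Sym_circle_def)
  obtain H where H: "circle_lift f H" "strict_mono H"
    using assms by (auto simp: Sym_circle_def quasisymmetric_def circle_homeo_plus_def)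
  obtain c where "\<And>x. G x = H x + c" using circle_lift_unique[OF G(1) H(1)] by blast
  then have "strict_mono G" using H(2) by (simp add: strict_mono_def)
  then show ?thesis using that G by blast
qed

text \<open>The derivative of the lift is nonnegative by monotonicity, and it does not vanish because the
  composition with a differentiable lift of the inverse is a translation.\<close>
lemma circle_diffeo_holder_lift:
  assumes g: "g \<in> circle_diffeo_holder \<alpha>"
  obtains G where "circle_lift g G" "holder_diffeo_on \<alpha> UNIV G"
proof -
  have gd: "g \<in> circle_homeo_plus" "circle_C1 g" "circle_C1 (inv\<^bsub>circle_bij\<^esub> g)"
    using g by (auto simp: circle_diffeo_holder_def circle_diffeo_plus_def)
  obtain G0 where G0: "circle_lift g G0" "strict_mono G0"
    using gd(1) by (auto simp: circle_homeo_plus_def)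
  obtain G where G: "circle_lift g G" "\<And>x. G differentiable (at x)"
    using gd(2) by (auto simp: circle_C1_def)
  obtain K where K: "circle_lift (inv\<^bsub>circle_bij\<^esub> g) K" "\<And>x. K differentiable (at x)"
    using gd(3) by (auto simp: circle_C1_def)
  obtain G2 where G2: "circle_lift g G2" "holder_on \<alpha> UNIV (deriv G2)"
    using g by (auto simp: circle_diffeo_holder_def holder_on_def)
  have derG: "(G has_real_derivative deriv G x) (at x)" for x
    using G(2) by (simp add: DERIV_deriv_iff_real_differentiable)
  have derK: "(K has_real_derivative deriv K x) (at x)" for x
    using K(2) by (simp add: DERIV_deriv_iff_real_differentiable)
  obtain c0 where "\<And>x. G x = G0 x + c0" using circle_lift_unique[OF G(1) G0(1)] by blast
  then have mono: "strict_mono G" using G0(2) by (simp add: strict_mono_def)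
  obtain c2 where c2: "\<And>x. G2 x = G x + c2" using circle_lift_unique[OF G2(1) G(1)] by blast
  have "G2 = (\<lambda>x. G x + c2)" using c2 by (rule ext)
  then have "deriv G2 x = deriv G x" for x
    by (intro DERIV_imp_deriv) (auto intro!: derivative_eq_intros derG)
  with G2(2) have hol: "holder_on \<alpha> UNIV (deriv G)" by (rule holder_on_cong)
  have "deriv G x > 0" for x
  proof -
    have "deriv G x \<ge> 0"
      using mono_on_imp_deriv_nonneg[of UNIV G] derG mono
      by (auto simp: strict_mono_mono)
    moreover have "deriv G x \<noteq> 0"
    proof -
      have KG: "cis (K (G x)) = cis x" for x
      proof -
        have "cis (K (G x)) = (inv\<^bsub>circle_bij\<^esub> g) (g (cis x))"
          using K(1) G(1) by (simp add: circle_lift_def)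
        also have "\<dots> = cis x"
          by (rule circle_bij_apply_inv(1)[OF circle_homeo_plus_in_carrier[OF gd(1)] cis_in_unit_circle])
        finally show ?thesis .
      qed
      have contKG: "continuous_on UNIV (\<lambda>x. K (G x))"
        using K(1) G(1) by (auto simp: circle_lift_def intro: continuous_on_compose2[of UNIV K])
      obtain c where c: "\<And>x. K (G x) = x + c"
        by (rule cis_eq_cis_imp_differ_by_constant[OF contKG continuous_on_id KG]) (rule that)
      have "((\<lambda>x. K (G x)) has_real_derivative deriv K (G x) * deriv G x) (at x)"
        by (rule DERIV_chain2[OF derK derG])
      moreover have "((\<lambda>x. K (G x)) has_real_derivative 1) (at x)"
        unfolding c by (auto intro!: derivative_eq_intros)
      ultimately have "deriv K (G x) * deriv G x = 1" by (rule DERIV_unique)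
      then show ?thesis by auto
    qed
    ultimately show ?thesis by simp
  qed
  then have "holder_diffeo_on \<alpha> UNIV G" unfolding holder_diffeo_on_def using derG hol by blast
  then show ?thesis using that G(1) by blast
qed

text \<open>Conversely, the inverse of the lift is a lift of the inverse, and it is continuously
  differentiable by the inverse function rule.\<close>
lemma circle_diffeo_holderI:
  assumes f: "f \<in> circle_homeo_plus" and lift: "circle_lift f \<Phi>" and mono: "strict_mono \<Phi>"
    and hol: "holder_diffeo_on \<alpha> UNIV \<Phi>" and \<alpha>: "\<alpha> > 0"
  shows "f \<in> circle_diffeo_holder \<alpha>"
proof -
  obtain \<Phi>' where \<Phi>': "\<And>x. (\<Phi> has_real_derivative \<Phi>' x) (at x)" "\<And>x. \<Phi>' x > 0" "holder_on \<alpha> UNIV \<Phi>'"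
    by (rule holder_diffeo_onE[OF hol]) blast
  have deriv: "deriv \<Phi> = \<Phi>'" by (rule ext) (rule DERIV_imp_deriv[OF \<Phi>'(1)])
  have cont': "continuous_on UNIV \<Phi>'" using \<Phi>'(3) \<alpha> by (rule holder_on_imp_continuous_on)
  have C1: "circle_C1 f" unfolding circle_C1_def
    using lift \<Phi>'(1) cont' deriv by (intro exI[of _ \<Phi>]) (auto simp: real_differentiable_def)
  define K where "K = inv_into UNIV \<Phi>"
  have bij: "bij \<Phi>" using lift mono by (rule circle_lift_bij)
  have K: "\<Phi> (K y) = y" "K (\<Phi> x) = x" for x y
    using bij by (auto simp: K_def bij_is_surj surj_f_inv_f bij_is_inj inv_f_f)
  have "x \<le> y \<Longrightarrow> K x \<le> K y" for x y
    using strict_mono_less_eq[OF mono, of "K x" "K y"] K by simp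
  moreover have "range K = UNIV" using K(2) by (metis surjI)
  ultimately have contK: "continuous_on UNIV K"
    by (intro continuous_onI_mono) auto
  have derK: "(K has_real_derivative inverse (\<Phi>' (K y))) (at y)" for y
    by (rule DERIV_inverse_function[where f = \<Phi> and a = "y - 1" and b = "y + 1"])
       (use \<Phi>' K contK less_imp_neq[OF \<Phi>'(2), of "K y"] in \<open>auto simp: continuous_on_eq_continuous_at\<close>)
  have "circle_lift (inv\<^bsub>circle_bij\<^esub> f) K"
    unfolding circle_lift_def
  proof (intro conjI contK allI)
    fix y
    have "(inv\<^bsub>circle_bij\<^esub> f) (f (cis (K y))) = cis (K y)"
      by (rule circle_bij_apply_inv(1)[OF circle_homeo_plus_in_carrier[OF f] cis_in_unit_circle])
    then show "(inv\<^bsub>circle_bij\<^esub> f) (cis y) = cis (K y)"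
      using lift by (simp add: circle_lift_def K)
  qed
  moreover have "deriv K = (\<lambda>y. inverse (\<Phi>' (K y)))" by (rule ext) (rule DERIV_imp_deriv[OF derK])
  moreover have "continuous_on UNIV (\<lambda>y. inverse (\<Phi>' (K y)))"
    using \<Phi>'(2) continuous_on_compose2[OF cont' contK] by (intro continuous_on_inverse) (auto simp: less_imp_neq[symmetric])
  ultimately have "circle_C1 (inv\<^bsub>circle_bij\<^esub> f)"
    unfolding circle_C1_def using derK by (intro exI[of _ K]) (auto simp: real_differentiable_def)
  with f C1 have "f \<in> circle_diffeo_plus" by (simp add: circle_diffeo_plus_def)
  then show ?thesis
    unfolding circle_diffeo_holder_def using lift \<Phi>'(3) deriv by (auto simp: holder_on_def)
qed

section \<open>Hyperbolic Moebius transformations in a linear chart\<close>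

text \<open>The angle of the image of \<open>w\<close> under the Cayley type transformation
  \<open>w \<mapsto> e\<^sup>i\<^sup>\<rho> (w - \<i>) / (w + \<i>)\<close>, which maps the real line onto the circle minus
  \<open>e\<^sup>i\<^sup>\<rho>\<close>; written with \<open>arctan\<close> it increases continuously from \<open>\<rho> - 2 \<pi>\<close> to \<open>\<rho>\<close>.\<close>
definition circle_chart :: "real \<Rightarrow> real \<Rightarrow> real" where
  "circle_chart \<rho> w = \<rho> - pi + 2 * arctan w"

lemma cis_double_arctan: "cis (2 * arctan w) * (1 - \<i> * w) = 1 + \<i> * w"
proof -
  define a where "a = arctan w"
  have cos: "cos a \<noteq> 0" by (simp add: a_def)
  have sin: "sin a = w * cos a"
    using cos tan_arctan[of w] by (simp add: a_def tan_def field_simps)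
  have minus: "cos a * (1 - \<i> * w) = cis (- a)" and plus: "cos a * (1 + \<i> * w) = cis a"
    by (simp_all add: complex_eq_iff sin)
  have "cos a * (cis (2 * a) * (1 - \<i> * w)) = cis (2 * a) * (cos a * (1 - \<i> * w))"
    by (rule mult.left_commute)
  also have "\<dots> = cos a * (1 + \<i> * w)"
    unfolding minus plus cis_mult by simp
  finally have "cos a * (cis (2 * a) * (1 - \<i> * w)) = cos a * (1 + \<i> * w)" .
  then show ?thesis using cos by (simp add: a_def)
qed

lemma cis_circle_chart: "cis (circle_chart \<rho> w) * (w + \<i>) = cis \<rho> * (w - \<i>)"
proof -
  have "cis (circle_chart \<rho> w) = - cis \<rho> * cis (2 * arctan w)"
    by (simp add: circle_chart_def cis_mult minus_cis')
  moreover have "cis (2 * arctan w) * (w + \<i>) = \<i> - w"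
    using arg_cong[OF cis_double_arctan[of w], of "\<lambda>x. \<i> * x"] by (simp add: algebra_simps)
  ultimately have "cis (circle_chart \<rho> w) * (w + \<i>) = - cis \<rho> * (\<i> - w)"
    by (simp only: mult.assoc)
  then show ?thesis by (simp add: algebra_simps)
qed

text \<open>Up to a constant factor, the coordinate \<open>w - w0\<close> of a point \<open>z\<close> is the quotient
  \<open>(z - p) / (z - r)\<close>, where \<open>p\<close> is the point with coordinate \<open>w0\<close> and \<open>r\<close> the omitted point.\<close>
lemma circle_chart_cross_ratio:
  "(cis (circle_chart \<rho> w) - cis (circle_chart \<rho> w0)) * (w0 + \<i>)
     = - (w - w0) * (cis (circle_chart \<rho> w) - cis \<rho>)"
proof -
  define z p r where "z = cis (circle_chart \<rho> w)" and "p = cis (circle_chart \<rho> w0)" and "r = cis \<rho>"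
  have "(z - p) * (w0 + \<i>) + (w - w0) * (z - r)
      = (z * (w + \<i>) - r * (w - \<i>)) - (p * (w0 + \<i>) - r * (w0 - \<i>))"
    by (simp add: algebra_simps)
  also have "\<dots> = 0"
    using cis_circle_chart[of \<rho> w] cis_circle_chart[of \<rho> w0] by (simp add: z_def p_def r_def)
  finally show ?thesis 
    by (simp only: z_def p_def r_def eq_neg_iff_add_eq_0 mult_minus_left of_real_diff of_real_minus)
qed

lemma circle_chart_avoids: "cis (circle_chart \<rho> w) \<noteq> cis \<rho>"
proof
  assume "cis (circle_chart \<rho> w) = cis \<rho>"
  then have "cis \<rho> * (w + \<i>) = cis \<rho> * (w - \<i>)" using cis_circle_chart[of \<rho> w] by simp
  then have "w + \<i> = w - \<i>" by simp
  then show False by (simp add: complex_eq_iff)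
qed

lemma circle_chartE:
  assumes "z \<in> unit_circle" "z \<noteq> cis \<rho>" obtains w where "z = cis (circle_chart \<rho> w)"
proof -
  have "z / cis (\<rho> - pi) \<in> unit_circle" using assms(1) by (simp add: norm_divide)
  then obtain x where x: "z / cis (\<rho> - pi) = cis x" "- pi < x" "x \<le> pi"
    by (rule unit_circle_cisE)
  have "z = cis (\<rho> - pi) * cis x" using x(1) by (simp add: nonzero_divide_eq_eq mult.commute)
  then have z: "z = cis (\<rho> - pi + x)" by (simp only: cis_mult)
  then have "x \<noteq> pi" using assms(2) by auto
  then have "2 * arctan (tan (x / 2)) = x" using x arctan_tan[of "x / 2"] by simp
  then show ?thesis using that[of "tan (x / 2)"] z by (simp add: circle_chart_def)
qed

text \<open>A Moebius transformation with fixed points \<open>p\<close> and \<open>r\<close> multiplies \<open>(z - p) / (z - r)\<close> by a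
  constant \<open>K\<close>.  As the chart is real on the circle, \<open>K\<close> is real, and \<open>K = 1\<close> would
  give further fixed points.\<close>
lemma Mob_circle_linear_in_chart:
  assumes \<gamma>: "\<gamma> \<in> Mob_circle" "\<gamma> \<in> carrier circle_bij"
    and fixed: "{z \<in> unit_circle. \<gamma> z = z} = {p, cis \<rho>}" "p \<noteq> cis \<rho>"
  obtains v0 A where "A \<noteq> 1"
    "\<And>v. \<gamma> (cis (circle_chart \<rho> (v0 + v))) = cis (circle_chart \<rho> (v0 + A * v))"
proof -
  define r where "r = cis \<rho>"
  have bij: "bij_betw \<gamma> unit_circle unit_circle"
    using \<gamma>(2) by (simp add: BijGroup_def Bij_def)
  have p: "p \<in> unit_circle" "\<gamma> p = p" and r: "r \<in> unit_circle" "\<gamma> r = r"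
    using fixed by (auto simp: r_def)
  obtain a b c d where abcd: "a * d - b * c \<noteq> 0" "\<gamma> = restrict (moebius a b c d) unit_circle"
    using \<gamma>(1) by (auto simp: Mob_circle_def)
  have \<gamma>_circle: "\<gamma> z \<in> unit_circle" if "z \<in> unit_circle" for z
    using bij_betw_apply[OF bij that] .
  have \<gamma>_eq: "\<gamma> z = (a * z + b) / (c * z + d)" if "z \<in> unit_circle" for z
    using that unfolding abcd(2) moebius_def by simp
  have denom: "c * z + d \<noteq> 0" if "z \<in> unit_circle" for z
    using \<gamma>_circle[OF that] \<gamma>_eq[OF that] by auto
  have diff: "(\<gamma> z - \<gamma> y) * ((c * z + d) * (c * y + d)) = (a * d - b * c) * (z - y)"
    if "z \<in> unit_circle" "y \<in> unit_circle" for z y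
  proof -
    have "(\<gamma> z - \<gamma> y) * ((c * z + d) * (c * y + d))
        = (\<gamma> z * (c * z + d)) * (c * y + d) - (\<gamma> y * (c * y + d)) * (c * z + d)"
      by (simp add: algebra_simps)
    also have "\<dots> = (a * z + b) * (c * y + d) - (a * y + b) * (c * z + d)"
      using denom that by (simp add: \<gamma>_eq)
    finally show ?thesis by (simp add: algebra_simps)
  qed
  obtain v0 where v0: "p = cis (circle_chart \<rho> v0)"
    using circle_chartE[OF p(1) fixed(2)] by blast
  have i: "of_real v0 + \<i> \<noteq> 0" by (simp add: complex_eq_iff)
  define K where "K = (c * r + d) / (c * p + d)"
  have linear: "\<exists>v'. \<gamma> (cis (circle_chart \<rho> (v0 + v))) = cis (circle_chart \<rho> (v0 + v')) \<and> of_real v' = K * of_real v" for v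
  proof -
    define z where "z = cis (circle_chart \<rho> (v0 + v))"
    have z: "z \<in> unit_circle" "z \<noteq> r" by (simp_all add: z_def r_def circle_chart_avoids)
    have "\<gamma> z \<noteq> r"
      using bij_betw_imp_inj_on[OF bij] z r by (metis inj_onD)
    then obtain w where w: "\<gamma> z = cis (circle_chart \<rho> w)"
      using circle_chartE[OF \<gamma>_circle[OF z(1)]] by (auto simp: r_def)
    define v' where "v' = w - v0"
    have ratio_z: "(z - p) * (v0 + \<i>) = - v * (z - r)"
      using circle_chart_cross_ratio[of \<rho> "v0 + v" v0] by (simp add: z_def v0 r_def)
    have ratio_\<gamma>z: "(\<gamma> z - p) * (v0 + \<i>) = - v' * (\<gamma> z - r)"
      using circle_chart_cross_ratio[of \<rho> w v0] by (simp add: w v0 r_def v'_def)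
    have cross: "(\<gamma> z - p) * (c * p + d) * (z - r) = (\<gamma> z - r) * (c * r + d) * (z - p)"
    proof -
      have "(c * z + d) * ((\<gamma> z - p) * (c * p + d) * (z - r))
          = ((\<gamma> z - \<gamma> p) * ((c * z + d) * (c * p + d))) * (z - r)"
        by (simp add: p mult_ac)
      also have "\<dots> = ((a * d - b * c) * (z - r)) * (z - p)"
        unfolding diff[OF z(1) p(1)] by (simp only: mult_ac)
      also have "\<dots> = ((\<gamma> z - \<gamma> r) * ((c * z + d) * (c * r + d))) * (z - p)"
        by (simp only: diff[OF z(1) r(1)])
      also have "\<dots> = (c * z + d) * ((\<gamma> z - r) * (c * r + d) * (z - p))"
        by (simp add: r mult_ac)
      finally show ?thesis using denom[OF z(1)] by simp
    qed
    have "(- v' * (\<gamma> z - r)) * (c * p + d) * (z - r) = (\<gamma> z - r) * (c * r + d) * (- v * (z - r))"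
      using arg_cong[OF cross, of "\<lambda>x. (v0 + \<i>) * x"]
      unfolding ratio_z[symmetric] ratio_\<gamma>z[symmetric] by (simp only: mult_ac)
    then have "((\<gamma> z - r) * (z - r)) * (v' * (c * p + d)) = ((\<gamma> z - r) * (z - r)) * (v * (c * r + d))"
      by (simp add: mult_ac)
    then have "of_real v' * (c * p + d) = of_real v * (c * r + d)"
      using z(2) \<open>\<gamma> z \<noteq> r\<close> by simp
    then have "of_real v' = K * of_real v"
      using denom[OF p(1)] by (simp add: K_def field_simps)
    then show ?thesis using w by (intro exI[of _ v']) (simp add: z_def v'_def)
  qed
  \<comment> \<open>The image of the point with coordinate \<open>1\<close> has real coordinate \<open>K\<close>.\<close>
  obtain A where A: "of_real A = K"
    using linear[of 1] by auto
  have conj: "\<gamma> (cis (circle_chart \<rho> (v0 + v))) = cis (circle_chart \<rho> (v0 + A * v))" for v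
  proof -
    obtain v' where v': "\<gamma> (cis (circle_chart \<rho> (v0 + v))) = cis (circle_chart \<rho> (v0 + v'))"
      "complex_of_real v' = K * of_real v" using linear[of v] by blast
    then have "v' = A * v" unfolding A[symmetric] of_real_mult[symmetric] of_real_eq_iff by simp
    then show ?thesis using v'(1) by simp
  qed
  moreover have "A \<noteq> 1"
  proof
    assume "A = 1"
    define z where "z = cis (circle_chart \<rho> (v0 + 1))"
    have "z \<in> {p, cis \<rho>}"
      unfolding fixed(1)[symmetric] using conj[of 1] \<open>A = 1\<close> by (simp add: z_def)
    then have "z = p" using circle_chart_avoids by (auto simp: z_def)
    then show False
      using circle_chart_cross_ratio[of \<rho> "v0 + 1" v0] circle_chart_avoids[of \<rho> "v0 + 1"]
      by (auto simp: z_def v0)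
  qed
  ultimately show ?thesis using that by blast
qed

section \<open>Regularity of symmetric conjugacies\<close>

text \<open>A lift of \<open>g\<close> satisfies the conjugacy relation up to a constant, which is absorbed into the
  lift.  Positivity of \<open>A\<close> expresses that \<open>\<gamma>\<close> preserves orientation, a property that it inherits from
  the increasing lifts of \<open>f\<close> and \<open>g\<close>.\<close>
lemma conjugacy_lift:
  assumes \<Phi>: "circle_lift f \<Phi>" "strict_mono \<Phi>" and g: "g \<in> circle_diffeo_holder \<alpha>"
    and gf: "\<And>z. z \<in> unit_circle \<Longrightarrow> g (f z) = f (\<gamma> z)"
    and \<gamma>: "\<And>v. \<gamma> (cis (circle_chart \<rho> (v0 + v))) = cis (circle_chart \<rho> (v0 + A * v))"
  obtains G where "holder_diffeo_on \<alpha> UNIV G" "0 < A"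
    "\<And>v. G (\<Phi> (circle_chart \<rho> (v0 + v))) = \<Phi> (circle_chart \<rho> (v0 + A * v))"
proof -
  obtain G where G: "circle_lift g G" "holder_diffeo_on \<alpha> UNIV G"
    using circle_diffeo_holder_lift[OF g] by blast
  obtain G' where G': "\<And>x. (G has_real_derivative G' x) (at x)" "\<And>x. G' x > 0" "holder_on \<alpha> UNIV G'"
    by (rule holder_diffeo_onE[OF G(2)]) blast
  define F where "F v = \<Phi> (circle_chart \<rho> (v0 + v))" for v
  have F_mono: "F v < F w" if "v < w" for v w
    unfolding F_def circle_chart_def using that by (intro strict_monoD[OF \<Phi>(2)]) (simp add: arctan_less_iff)
  have contF: "continuous_on UNIV F"
    unfolding F_def circle_chart_def
    by (rule continuous_on_compose2[of UNIV \<Phi>]) (use \<Phi>(1) in \<open>auto simp: circle_lift_def intro!: continuous_intros\<close>)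
  have contG: "continuous_on UNIV G" using G(1) by (simp add: circle_lift_def)
  have lifted: "cis (G (F v)) = cis (F (A * v))" for v
  proof -
    have "cis (G (F v)) = g (f (cis (circle_chart \<rho> (v0 + v))))"
      using G(1) \<Phi>(1) by (simp add: circle_lift_def F_def)
    also have "\<dots> = f (cis (circle_chart \<rho> (v0 + A * v)))"
      by (simp add: gf \<gamma>)
    also have "\<dots> = cis (F (A * v))"
      using \<Phi>(1) by (simp add: circle_lift_def F_def)
    finally show ?thesis .
  qed
  have cont1: "continuous_on UNIV (\<lambda>v. G (F v))"
    by (rule continuous_on_compose2[OF contG contF]) simp
  have cont2: "continuous_on UNIV (\<lambda>v. F (A * v))"
    by (rule continuous_on_compose2[OF contF]) (auto intro: continuous_intros)
  obtain c where c: "\<And>v. G (F v) = F (A * v) + c"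
    by (rule cis_eq_cis_imp_differ_by_constant[OF cont1 cont2 lifted]) (rule that)
  have "G (F 0) < G (F 1)"
    by (rule DERIV_pos_imp_increasing[OF F_mono]) (use G' in auto)
  then have "F 0 < F A" using c[of 0] c[of 1] by simp
  have "0 < A"
  proof (rule ccontr)
    assume "\<not> 0 < A"
    then have "A = 0 \<or> A < 0" by auto
    then show False using F_mono[of A 0] \<open>F 0 < F A\<close> by auto
  qed
  moreover have "holder_diffeo_on \<alpha> UNIV (\<lambda>x. G x - c)"
    unfolding holder_diffeo_on_def
    using G' by (intro exI[of _ G']) (auto intro!: derivative_eq_intros)
  moreover have "G (\<Phi> (circle_chart \<rho> (v0 + v))) - c = \<Phi> (circle_chart \<rho> (v0 + A * v))" for v
    using c[of v] by (simp add: F_def)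
  ultimately show ?thesis using that[of "\<lambda>x. G x - c"] by blast
qed

text \<open>Here \<open>e\<^sup>i\<^sup>\<rho>\<close> is the repelling fixed point, and the open interval from \<open>\<rho> - 2 \<pi>\<close> to \<open>\<rho>\<close> is a
  lift of its complement.  The regularity of \<open>\<Phi>\<close> in the linear coordinate is carried back to the
  angle by the inverse \<open>\<tau>\<close> of the chart, which is smooth; that its derivative is \<open>\<alpha>\<close>-Hoelder on compact
  intervals uses \<open>\<alpha> \<le> 1\<close>.\<close>
lemma holder_diffeo_away_from_repelling_point:
  assumes \<alpha>: "0 < \<alpha>" "\<alpha> \<le> 1"
    and \<Phi>: "continuous_on UNIV \<Phi>" "strict_mono \<Phi>"
      "uniform_limit UNIV (\<lambda>t x. qs_ratio \<Phi> x t) (\<lambda>_. 1) (at_right 0)"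
    and G: "holder_diffeo_on \<alpha> UNIV G" and A: "0 < A" "A < 1"
    and conj: "\<And>v. G (\<Phi> (circle_chart \<rho> (v0 + v))) = \<Phi> (circle_chart \<rho> (v0 + A * v))"
    and ab: "\<rho> - 2 * pi < a" "b < \<rho>"
  shows "holder_diffeo_on \<alpha> {a..b} \<Phi>"
proof -
  define E where "E v = circle_chart \<rho> (v0 + v)" for v
  define \<tau> where "\<tau> x = tan ((x - \<rho> + pi) / 2) - v0" for x
  define e where "e = 2 / (1 + v0\<^sup>2)"
  have pos: "1 + v0\<^sup>2 > 0" by (simp add: add_pos_nonneg)
  have cos_pos: "cos ((x - \<rho> + pi) / 2) > 0" if "\<rho> - 2 * pi < x" "x < \<rho>" for x
    using that by (intro cos_gt_zero_pi) (auto simp: field_simps)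
  have \<tau>': "(\<tau> has_real_derivative inverse ((cos ((x - \<rho> + pi) / 2))\<^sup>2) / 2) (at x)"
    if "\<rho> - 2 * pi < x" "x < \<rho>" for x
    unfolding \<tau>_def using cos_pos[OF that] by (auto intro!: derivative_eq_intros)
  have E\<tau>: "E (\<tau> x) = x" if "\<rho> - 2 * pi < x" "x < \<rho>" for x
    using that arctan_tan[of "(x - \<rho> + pi) / 2"] by (auto simp: E_def \<tau>_def circle_chart_def field_simps)
  have E0: "\<rho> - 2 * pi < E 0" "E 0 < \<rho>"
    using arctan_bounded[of v0] by (auto simp: E_def circle_chart_def)
  interpret symmetric_conjugacy \<alpha> A e \<Phi> G E \<tau>
  proof
    show "continuous_on UNIV E" unfolding E_def circle_chart_def by (intro continuous_intros)
    show "strict_mono E" unfolding E_def circle_chart_def by (simp add: strict_mono_def arctan_less_iff)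
    show "(E has_real_derivative e) (at 0)"
      unfolding E_def circle_chart_def e_def by (auto intro!: derivative_eq_intros simp: divide_inverse)
    show "e > 0" using pos by (simp add: e_def)
    show "\<tau> (E v) = v" for v by (simp add: \<tau>_def E_def circle_chart_def tan_arctan)
    have "(E 0 - \<rho> + pi) / 2 = arctan v0" by (simp add: E_def circle_chart_def)
    moreover have "(cos (arctan v0))\<^sup>2 = 1 / (1 + v0\<^sup>2)"
      using pos by (simp add: cos_arctan power_divide)
    ultimately show "(\<tau> has_real_derivative inverse e) (at (E 0))"
      using \<tau>'[OF E0] by (simp add: e_def)
    show "\<forall>\<^sub>F y in nhds (E 0). E (\<tau> y) = y"
      unfolding eventually_nhds using E0 E\<tau> by (intro exI[of _ "{\<rho> - 2 * pi<..<\<rho>}"]) auto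
    show "G (\<Phi> (E v)) = \<Phi> (E (A * v))" for v unfolding E_def by (rule conj)
  qed (use assms in auto)
  have \<tau>_diffeo: "holder_diffeo_on \<alpha> {a..b} \<tau>"
  proof -
    define u where "u x = (x - \<rho> + pi) / 2" for x
    define t where "t x = inverse ((cos (u x))\<^sup>2) / 2" for x
    define t' where "t' x = sin (u x) / (cos (u x)) ^ 3 / 2" for x
    have cu: "cos (u x) > 0" if "x \<in> {a..b}" for x
      unfolding u_def using that ab by (intro cos_pos) auto
    have der: "(t has_real_derivative t' x) (at x within {a..b})" if "x \<in> {a..b}" for x
      unfolding t_def t'_def u_def using cu[OF that, unfolded u_def]
      by (auto intro!: derivative_eq_intros simp: field_simps power2_eq_square power3_eq_cube)
    have "continuous_on {a..b} t'"
      unfolding t'_def u_def using cu[unfolded u_def] by (auto intro!: continuous_intros simp: less_imp_neq[symmetric])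
    then have "bounded (t' ` {a..b})" by (intro compact_imp_bounded compact_continuous_image) auto
    then obtain C where C: "C > 0" "\<forall>y\<in>t' ` {a..b}. norm y \<le> C"
      unfolding bounded_pos by blast
    have "C-lipschitz_on {a..b} t"
      by (rule lipschitz_on_of_deriv_bound[where f' = t']) (use der C in auto)
    then have "holder_on \<alpha> {a..b} t" using \<alpha> by (rule lipschitz_on_imp_holder_on)
    moreover have "(\<tau> has_real_derivative t x) (at x)" "t x > 0" if "x \<in> {a..b}" for x
      using \<tau>'[of x] cu[OF that] that ab by (auto simp: t_def u_def)
    ultimately show ?thesis unfolding holder_diffeo_on_def by blast
  qed
  then have "continuous_on {a..b} \<tau>"
    by (auto elim!: holder_diffeo_onE intro!: continuous_at_imp_continuous_on DERIV_isCont)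
  then have "bounded (\<tau> ` {a..b})" by (intro compact_imp_bounded compact_continuous_image) auto
  then obtain R where R: "\<forall>y\<in>\<tau> ` {a..b}. norm y \<le> R"
    unfolding bounded_iff by blast
  have "holder_diffeo_on \<alpha> {a..b} (\<lambda>x. \<Phi> (E (\<tau> x)))"
    by (rule holder_diffeo_on_compose[OF \<tau>_diffeo holder_diffeo_on_basin[of R] _ \<alpha>(1)])
       (use R in \<open>force simp: abs_le_iff\<close>)
  then show ?thesis
    by (rule holder_diffeo_on_cong_open[of _ _ _ "{\<rho> - 2 * pi<..<\<rho>}"]) (use ab E\<tau> in auto)
qed

theorem theorem4p1:
  fixes \<alpha> :: real and \<Gamma> :: "(complex \<Rightarrow> complex) set" and f :: "complex \<Rightarrow> complex"
  assumes "0 < \<alpha>" and "\<alpha> < 1"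
    and "subgroup \<Gamma> circle_bij" and "\<Gamma> \<subseteq> Mob_circle"
    and "\<exists>\<gamma>\<in>\<Gamma>. hyperbolic \<gamma>"
    and "f \<in> Sym_circle"
    and "(\<lambda>\<gamma>. f \<otimes>\<^bsub>circle_bij\<^esub> \<gamma> \<otimes>\<^bsub>circle_bij\<^esub> inv\<^bsub>circle_bij\<^esub> f) ` \<Gamma>
           \<subseteq> circle_diffeo_holder \<alpha>"
  shows "f \<in> circle_diffeo_holder \<alpha>"
proof -
  have group: "group circle_bij" by (rule group_BijGroup)
  obtain \<gamma> where \<gamma>: "\<gamma> \<in> \<Gamma>" "hyperbolic \<gamma>" using assms(5) by blast
  obtain \<Phi> where \<Phi>: "circle_lift f \<Phi>" "strict_mono \<Phi>"
    "uniform_limit UNIV (\<lambda>t x. qs_ratio \<Phi> x t) (\<lambda>_. 1) (at_right 0)"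
    using Sym_circle_lift[OF assms(6)] by blast
  have cont: "continuous_on UNIV \<Phi>" using \<Phi>(1) by (simp add: circle_lift_def)
  have f: "f \<in> circle_homeo_plus" using assms(6) by (simp add: Sym_circle_def quasisymmetric_def)
  have f_bij: "f \<in> carrier circle_bij" by (rule circle_homeo_plus_in_carrier[OF f])
  have \<Gamma>_bij: "\<beta> \<in> carrier circle_bij" if "\<beta> \<in> \<Gamma>" for \<beta>
    using subgroup.mem_carrier[OF assms(3) that] .
  have conjugate: "\<exists>g \<in> circle_diffeo_holder \<alpha>. \<forall>z\<in>unit_circle. g (f z) = f (\<beta> z)" if "\<beta> \<in> \<Gamma>" for \<beta>
  proof -
    define g where "g = f \<otimes>\<^bsub>circle_bij\<^esub> \<beta> \<otimes>\<^bsub>circle_bij\<^esub> inv\<^bsub>circle_bij\<^esub> f"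
    have closed: "f \<otimes>\<^bsub>circle_bij\<^esub> \<beta> \<in> carrier circle_bij" "inv\<^bsub>circle_bij\<^esub> f \<in> carrier circle_bij"
      using group f_bij \<Gamma>_bij[OF that] by (auto intro: group.inv_closed monoid.m_closed group.is_monoid)
    have "g (f z) = f (\<beta> z)" if z: "z \<in> unit_circle" for z
    proof -
      have "g (f z) = (f \<otimes>\<^bsub>circle_bij\<^esub> \<beta>) ((inv\<^bsub>circle_bij\<^esub> f) (f z))"
        unfolding g_def by (rule circle_bij_mult_apply[OF closed circle_bij_apply_inv(4)[OF f_bij z]])
      also have "\<dots> = (f \<otimes>\<^bsub>circle_bij\<^esub> \<beta>) z"
        by (simp only: circle_bij_apply_inv(1)[OF f_bij z])
      also have "\<dots> = f (\<beta> z)"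
        by (rule circle_bij_mult_apply[OF f_bij \<Gamma>_bij[OF \<open>\<beta> \<in> \<Gamma>\<close>] z])
      finally show ?thesis .
    qed
    moreover have "g \<in> circle_diffeo_holder \<alpha>" unfolding g_def using assms(7) that by blast
    ultimately show ?thesis by blast
  qed
  \<comment> \<open>Either fixed point of \<open>\<gamma>\<close> may play the role of the omitted point \<open>cis \<rho>\<close>: it is repelling for
    \<open>\<gamma>\<close> or for its inverse.\<close>
  have away: "holder_diffeo_on \<alpha> {a..b} \<Phi>"
    if fixed: "{z \<in> unit_circle. \<gamma> z = z} = {p, cis \<rho>}" "p \<noteq> cis \<rho>" and ab: "\<rho> - 2 * pi < a" "b < \<rho>"
    for p \<rho> a b
  proof -
    obtain v0 A where A: "A \<noteq> 1"
      "\<And>v. \<gamma> (cis (circle_chart \<rho> (v0 + v))) = cis (circle_chart \<rho> (v0 + A * v))"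
      by (rule Mob_circle_linear_in_chart[OF subsetD[OF assms(4) \<gamma>(1)] \<Gamma>_bij[OF \<gamma>(1)] fixed]) (rule that)
    obtain g where g: "g \<in> circle_diffeo_holder \<alpha>" "\<And>z. z \<in> unit_circle \<Longrightarrow> g (f z) = f (\<gamma> z)"
      using conjugate[OF \<gamma>(1)] by blast
    obtain G where G: "holder_diffeo_on \<alpha> UNIV G" "0 < A"
      "\<And>v. G (\<Phi> (circle_chart \<rho> (v0 + v))) = \<Phi> (circle_chart \<rho> (v0 + A * v))"
      by (rule conjugacy_lift[OF \<Phi>(1,2) g A(2)]) (assumption, rule that)
    show ?thesis
    proof (cases "A < 1")
      case True
      then show ?thesis
        using holder_diffeo_away_from_repelling_point[OF assms(1) less_imp_le[OF assms(2)] cont \<Phi>(2,3) G(1,2) _ G(3) ab]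
        by blast
    next
      case False
      define \<beta> where "\<beta> = inv\<^bsub>circle_bij\<^esub> \<gamma>"
      have "\<beta> \<in> \<Gamma>" unfolding \<beta>_def using subgroup.m_inv_closed[OF assms(3) \<gamma>(1)] .
      have \<beta>: "\<beta> (cis (circle_chart \<rho> (v0 + v))) = cis (circle_chart \<rho> (v0 + inverse A * v))" for v
      proof -
        have "\<gamma> (cis (circle_chart \<rho> (v0 + inverse A * v))) = cis (circle_chart \<rho> (v0 + v))"
          unfolding A(2) using G(2) by (simp add: mult.assoc[symmetric])
        then show ?thesis
          unfolding \<beta>_def using circle_bij_apply_inv(1)[OF \<Gamma>_bij[OF \<gamma>(1)] cis_in_unit_circle] by metis
      qed
      obtain h where h: "h \<in> circle_diffeo_holder \<alpha>" "\<And>z. z \<in> unit_circle \<Longrightarrow> h (f z) = f (\<beta> z)"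
        using conjugate[OF \<open>\<beta> \<in> \<Gamma>\<close>] by blast
      obtain H where H: "holder_diffeo_on \<alpha> UNIV H" "0 < inverse A"
        "\<And>v. H (\<Phi> (circle_chart \<rho> (v0 + v))) = \<Phi> (circle_chart \<rho> (v0 + inverse A * v))"
        by (rule conjugacy_lift[OF \<Phi>(1,2) h \<beta>]) (assumption, rule that)
      have "inverse A < 1" using False A(1) by (simp add: inverse_less_1_iff)
      then show ?thesis
        using holder_diffeo_away_from_repelling_point[OF assms(1) less_imp_le[OF assms(2)] cont \<Phi>(2,3) H(1,2) _ H(3) ab]
        by blast
    qed
  qed
  obtain p r where pr: "{z \<in> unit_circle. \<gamma> z = z} = {p, r}" "p \<noteq> r"
    using \<gamma>(2) by (auto simp: hyperbolic_def card_2_iff)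
  have "p \<in> unit_circle" "r \<in> unit_circle" using pr(1) by blast+
  then obtain x y where xy: "p = cis x" "r = cis y" "- pi < x" "x \<le> pi" "- pi < y" "y \<le> pi"
    by (elim unit_circle_cisE) blast
  obtain x0 x1 where x01: "{z \<in> unit_circle. \<gamma> z = z} = {cis x0, cis x1}" "cis x0 \<noteq> cis x1" "x0 < x1" "x1 < x0 + 2 * pi"
  proof (cases "x < y")
    case True
    then show ?thesis using that[of x y] pr xy by auto
  next
    case False
    then have "y < x" using pr xy by (cases "x = y") auto
    then show ?thesis using that[of y x] pr xy by (auto simp: insert_commute)
  qed
  have cis_shift: "cis (x0 + 2 * pi) = cis x0" by (simp flip: cis_mult)
  \<comment> \<open>The midpoints \<open>m\<close> and \<open>m - \<pi>\<close> of the two arcs between the fixed points divide the circle into two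
    closed arcs, each of which contains only one of the fixed points.\<close>
  define m where "m = (x0 + x1) / 2"
  have left: "holder_diffeo_on \<alpha> {m - pi..m} \<Phi>"
    by (rule away[OF x01(1,2)]) (use x01(3,4) in \<open>auto simp: m_def field_simps\<close>)
  have right: "holder_diffeo_on \<alpha> {m..m - pi + 2 * pi} \<Phi>"
  proof (rule away)
    show "{z \<in> unit_circle. \<gamma> z = z} = {cis x1, cis (x0 + 2 * pi)}"
      unfolding cis_shift x01(1) by (rule insert_commute)
    show "cis x1 \<noteq> cis (x0 + 2 * pi)"
      unfolding cis_shift using x01(2) by (rule not_sym)
  qed (use x01(3,4) in \<open>auto simp: m_def field_simps\<close>)
  obtain c where c: "\<And>x. \<Phi> (x + 2 * pi) = \<Phi> x + c"
    using circle_lift_period[OF \<Phi>(1,2)] by blast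
  have "holder_diffeo_on \<alpha> UNIV \<Phi>"
    using assms(1) by (intro holder_diffeo_on_periodic[OF c _ _ left right]) auto
  then show ?thesis
    by (rule circle_diffeo_holderI[OF f \<Phi>(1,2) _ assms(1)])
qed

end
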